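(* Let $d\ge1$, $k\in\{1,\dots,d\}$, $p\ge1$, and let $\mu_\star\in\mathscr{P}(\mathbb{R}^d)$ satisfy a Bernstein tail condition with constants $\sigma,V>0$. Let $\widehat{\mu}_n=\frac1n\sum_{i=1}^n\delta_{X_i}$ be the empirical measure of $n\ge 1$ i.i.d. samples from $\mu_\star$. Then, for both $W=\underline{\mathcal{PW}}_{p,k}$ and $W=\overline{\mathcal{PW}}_{p,k}$, and for all $t>0$, $$\mathbb{P}\left(\left|W(\widehat{\mu}_n,\mu_\star)-\mathbb{E}[W(\widehat{\mu}_n,\mu_\star)]\right|\ge t\right)\ \le\ 2\exp\left(-\frac{t^2}{8\sigma^2n^{1-2/p}+4tVn^{-1/p}}\right).$$
   Context: $\|\cdot\|$ is the Euclidean norm. $\mathscr{P}(\mathbb{R}^d)$ is the set of Borel probability measures on $\mathbb{R}^d$. The Wasserstein distance of order $p$ is $\mathcal{W}_p(\mu,\nu)=\left(\inf_{\pi\in\Pi(\mu,\nu)}\int\|x-y\|^p d\pi(x,y)\right)^{1/p}$, with $\Pi(\mu,\nu)$ the set of couplings. $\mathbb{S}_{d,k}=\{E\in\mathbb{R}^{d\times k}:E^\top E=I_k\}$; for $E\in\mathbb{S}_{d,k}$, $E^\star_{\#}\mu\in\mathscr{P}(\mathbb{R}^k)$ is the push-forward of $\mu$ under $x\mapsto E^\top x$. The PRW and IPRW distances are $\overline{\mathcal{PW}}_{p,k}(\mu,\nu)=\sup_{E\in\mathbb{S}_{d,k}}\mathcal{W}_p(E^\star_{\#}\mu,E^\star_{\#}\nu)$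 and $\underline{\mathcal{PW}}_{p,k}(\mu,\nu)=\left(\int_{\mathbb{S}_{d,k}}\mathcal{W}_p^p(E^\star_{\#}\mu,E^\star_{\#}\nu)\,d\sigma(E)\right)^{1/p}$, with (in this formula) $\sigma$ the uniform distribution on $\mathbb{S}_{d,k}$. A measure $\mu\in\mathscr{P}(\mathbb{R}^d)$ satisfies a Bernstein tail condition if there exist constants $\sigma,V>0$ such that $\mathbb{E}_{X\sim\mu}\left[\sup_{E\in\mathbb{S}_{d,k}}\|E^\top X\|^r\right]\le\frac12\sigma^2r!\,V^{r-2}$ for all integers $r\ge2$. *)

theory Defs
  imports "HOL-Probability.Probability"
begin

text \<open>Real powers on \<^typ>\<open>ennreal\<close>; used for positive exponents only.\<close>

definition epowr :: "ennreal \<Rightarrow> real \<Rightarrow> ennreal" where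
  "epowr x a = (if x = \<infinity> then \<infinity> else ennreal (enn2real x powr a))"

definition couplings ::
  "'a::euclidean_space measure \<Rightarrow> 'a measure \<Rightarrow> ('a \<times> 'a) measure set" where
  "couplings \<mu> \<nu> = {\<pi>. prob_space \<pi> \<and> sets \<pi> = sets (borel \<Otimes>\<^sub>M borel) \<and>
     distr \<pi> borel fst = \<mu> \<and> distr \<pi> borel snd = \<nu>}"

definition wasserstein :: "real \<Rightarrow> 'a::euclidean_space measure \<Rightarrow> 'a measure \<Rightarrow> ennreal" where
  "wasserstein p \<mu> \<nu> =
     epowr (INF \<pi>\<in>couplings \<mu> \<nu>. \<integral>\<^sup>+ z. ennreal (norm (fst z - snd z) powr p) \<partial>\<pi>) (1 / p)"

definition stiefel :: "(real^'k^'d) set" where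
  "stiefel = {E. transpose E ** E = mat 1}"

definition projection_measure :: "real^'k^'d \<Rightarrow> (real^'d) measure \<Rightarrow> (real^'k) measure" where
  "projection_measure E \<mu> = distr \<mu> borel (\<lambda>x. transpose E *v x)"

text \<open>
  The uniform distribution on the Stiefel manifold is the Borel probability measure that is
  invariant under the action of the orthogonal group by left multiplication. As this action
  is transitive, the conditions below determine exactly one measure. It is
  represented as a measure on the ambient matrix space that is concentrated on the manifold.
\<close>

definition uniform_on_stiefel :: "(real^'k^'d) measure \<Rightarrow> bool" where
  "uniform_on_stiefel U \<longleftrightarrow>
     prob_space U \<and> sets U = sets borel \<and> emeasure U stiefel = 1 \<and>
     (\<forall>Q :: real^'d^'d. orthogonal_matrix Q \<longrightarrow> distr U borel (\<lambda>E. Q ** E) = U)"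

text \<open>The type argument of \<open>PRW\<close> carries the dimension of the projections.\<close>

definition PRW ::
  "'k::finite itself \<Rightarrow> real \<Rightarrow> (real^'d) measure \<Rightarrow> (real^'d) measure \<Rightarrow> ennreal" where
  "PRW _ p \<mu> \<nu> =
     (SUP E\<in>(stiefel :: (real^'k^'d) set).
        wasserstein p (projection_measure E \<mu>) (projection_measure E \<nu>))"

text \<open>
  In \<open>IPRW U p\<close> the measure \<open>U\<close> is to be the uniform distribution on the Stiefel manifold.
\<close>

definition IPRW ::
  "(real^'k^'d) measure \<Rightarrow> real \<Rightarrow> (real^'d) measure \<Rightarrow> (real^'d) measure \<Rightarrow> ennreal" where
  "IPRW U p \<mu> \<nu> =
     epowr (\<integral>\<^sup>+ E\<in>stiefel.
        epowr (wasserstein p (projection_measure E \<mu>) (projection_measure E \<nu>)) p \<partial>U) (1 / p)"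

text \<open>
  The expectation is a Lebesgue integral with values in \<^typ>\<open>ennreal\<close>, so the bound includes
  the finiteness of the moments.
\<close>

definition bernstein_tail ::
  "'k::finite itself \<Rightarrow> (real^'d) measure \<Rightarrow> real \<Rightarrow> real \<Rightarrow> bool" where
  "bernstein_tail _ \<mu> \<sigma> V \<longleftrightarrow>
     (\<forall>r::nat. r \<ge> 2 \<longrightarrow>
       (\<integral>\<^sup>+ x. (SUP E\<in>(stiefel :: (real^'k^'d) set). ennreal (norm (transpose E *v x) ^ r)) \<partial>\<mu>)
         \<le> ennreal (1 / 2 * \<sigma>\<^sup>2 * fact r * V ^ (r - 2)))"

definition empirical_measure :: "nat \<Rightarrow> (nat \<Rightarrow> 'a::topological_space) \<Rightarrow> 'a measure" where
  "empirical_measure n x = distr (uniform_count_measure {..<n}) borel x"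

lemma emeasure_empirical_measure:
  assumes "n \<ge> 1" and "A \<in> sets borel"
  shows "emeasure (empirical_measure n x) A =
    ennreal (1 / real n) * (\<Sum>i<n. emeasure (return borel (x i)) A)"
proof -
  have "emeasure (empirical_measure n x) A =
      emeasure (uniform_count_measure {..<n}) (x -` A \<inter> {..<n})"
    using assms
    by (simp add: empirical_measure_def emeasure_distr space_uniform_count_measure
        measurable_def sets_uniform_count_measure)
  also have "\<dots> = ennreal (card (x -` A \<inter> {..<n}) / n)"
    by (subst emeasure_uniform_count_measure) auto
  also have "real (card (x -` A \<inter> {..<n})) = (\<Sum>i<n. indicator A (x i))"
    by (simp add: indicator_def sum.If_cases Int_def vimage_def conj_commute)
  also have "ennreal ((\<Sum>i<n. indicator A (x i)) / n) =
      ennreal (1 / real n) * (\<Sum>i<n. emeasure (return borel (x i)) A)"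
    using assms(2)
    by (simp add: sum_nonneg ennreal_mult[symmetric] ennreal_indicator[symmetric]
        del: ennreal_indicator)
  finally show ?thesis .
qed

end

theory Submission
  imports Defs
begin

text \<open>
  For both distances, \<open>x \<mapsto> W (empirical_measure n x) \<mu>\<close> is Lipschitz: moving the atoms from \<open>y\<close>
  to \<open>x\<close> in a coupling costs at most \<open>n powr (- 1 / p) * \<Sum>\<^sub>i \<parallel>x\<^sub>i - y\<^sub>i\<parallel>\<close>, since projections onto \<open>k\<close>-frames are
  contractions. Because the orthogonal group acts transitively on spheres, the supremum in the
  Bernstein condition is just \<open>\<parallel>X\<parallel>\<^sup>r\<close>. Hence the martingale differences of the Lipschitz function have
  \<open>r\<close>-th absolute moments at most \<open>1/2 (2\<sigma>c)\<^sup>2 r! (2Vc)^(r - 2)\<close> with \<open>c = n powr (- 1 / p)\<close>, and Bernstein's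
  exponential moment bound followed by Chernoff's inequality gives exactly the stated constants.
\<close>

text \<open>The factor 2 in \<open>2 * c * \<sigma>\<close> and \<open>2 * c * V\<close> is the
  price of centring: \<open>h\<close> minus its mean is controlled by
  \<open>c * (norm x + m)\<close> with \<open>m\<close> the mean of \<open>norm\<close>, and the
  r-th moment of \<open>norm x + m\<close> can be 2^r times as large as that of
  \<open>norm x\<close>. The Lipschitz bound is in the sum of the displacements because that form
  survives integrating out coordinates one at a time, each with the same constant \<open>c\<close>;
  the n variance terms then add up to a multiple of n c^2 = n^(1 - 2/p). On the transport side, an
  infimum over couplings comes without a minimiser, so each comparison carries a slack
  \<open>e\<close>, which also keeps the radii in Minkowski's inequality positive. Moreover the
  distances are extended reals, and a one-sided Lipschitz bound says nothing at infinity: finiteness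
  is first established for the configuration of n zeros, from a finite p-th moment, and then spreads
  to all configurations.\<close>

section \<open>Convexity of powers and the exponential remainder\<close>

text \<open>The right side dominates its tangent at \<open>m\<close>. Averaging over
  \<open>u\<close> with mean \<open>m\<close> removes the linear term, so this one inequality gives
  both the power mean bound and Jensen's inequality below.\<close>

lemma power_tangent_le:
  fixes u m :: real
  assumes "0 \<le> u" "0 \<le> m"
  shows "m ^ r + real r * m ^ (r - 1) * (u - m) \<le> u ^ r"
proof (induction r)
  case (Suc r)
  \<comment> \<open>Multiplying the tangent for \<open>r\<close> by \<open>u\<close> overshoots the
    tangent for \<open>Suc r\<close> by a nonnegative multiple of (u - m)^2.\<close>
  have "m ^ Suc r + real (Suc r) * m ^ r * (u - m)
      = u * (m ^ r + real r * m ^ (r - 1) * (u - m)) - real r * m ^ (r - 1) * (u - m)\<^sup>2"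
    by (cases r) (simp_all add: algebra_simps power2_eq_square)
  also have "\<dots> \<le> u * (m ^ r + real r * m ^ (r - 1) * (u - m))"
    using assms by simp
  also have "\<dots> \<le> u * u ^ r"
    using Suc assms by (intro mult_left_mono) auto
  finally show ?case by simp
qed simp

text \<open>Add the tangent bounds for \<open>a\<close> and \<open>b\<close> at their midpoint; the
  slopes cancel.\<close>

lemma power_add_le_power_mean:
  fixes a b :: real
  assumes "0 \<le> a" "0 \<le> b"
  shows "2 * (a + b) ^ r \<le> 2 ^ r * (a ^ r + b ^ r)"
proof -
  let ?m = "(a + b) / 2"
  have "2 * ?m ^ r \<le> a ^ r + b ^ r"
    using power_tangent_le[of a ?m r] power_tangent_le[of b ?m r] assms
    by (simp add: algebra_simps add_divide_distrib)
  then show ?thesis by (simp add: power_divide field_simps)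
qed

lemma (in prob_space) expectation_power_le:
  fixes X :: "'a \<Rightarrow> real"
  assumes "integrable M X" "integrable M (\<lambda>x. X x ^ r)" "\<And>x. 0 \<le> X x"
  shows "expectation X ^ r \<le> expectation (\<lambda>x. X x ^ r)"
proof -
  let ?m = "expectation X"
  have "?m ^ r = expectation (\<lambda>x. ?m ^ r + real r * ?m ^ (r - 1) * (X x - ?m))"
    using assms by (simp add: prob_space)
  also have "\<dots> \<le> expectation (\<lambda>x. X x ^ r)"
    using assms by (intro integral_mono power_tangent_le integral_nonneg) auto
  finally show ?thesis .
qed

text \<open>The bound is kept as a series in \<open>ennreal\<close> so that it can be integrated
  term by term before the exponential is known to be integrable.\<close>

lemma exp_remainder_le:
  fixes x y :: real
  assumes "\<bar>x\<bar> \<le> y"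
  shows "ennreal (exp x - 1 - x) \<le> (\<Sum>k. ennreal (y ^ (k + 2) / fact (k + 2)))"
proof -
  have s: "summable (\<lambda>k. z ^ (k + 2) / fact (k + 2))" for z :: real
    using summable_exp[of z]
    by (subst summable_iff_shift[of "\<lambda>k. z ^ k / fact k"]) (simp add: field_simps)
  have "exp x - 1 - x = (\<Sum>k. x ^ (k + 2) / fact (k + 2))"
    by (subst exp_first_two_terms) (simp add: field_simps)
  also have "\<dots> \<le> (\<Sum>k. y ^ (k + 2) / fact (k + 2))"
  proof (intro suminf_le s divide_right_mono)
    fix k show "x ^ (k + 2) \<le> y ^ (k + 2)"
      using power_mono[OF assms, of "k + 2"] by (simp only: power_abs flip: power_abs) linarith
  qed simp
  finally have "ennreal (exp x - 1 - x) \<le> ennreal (\<Sum>k. y ^ (k + 2) / fact (k + 2))"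
    by (rule ennreal_leI)
  also have "\<dots> = (\<Sum>k. ennreal (y ^ (k + 2) / fact (k + 2)))"
    using assms by (intro suminf_ennreal2[symmetric] s) auto
  finally show ?thesis .
qed

section \<open>Exponential moments under Bernstein's condition\<close>

locale bernstein_moments = prob_space \<mu> for \<mu> :: "'b::euclidean_space measure" +
  fixes \<sigma> V :: real
  assumes sets_eq[measurable_cong]: "sets \<mu> = sets borel"
    and V_pos: "V > 0"
    and moment: "r \<ge> 2 \<Longrightarrow>
      (\<integral>\<^sup>+ x. ennreal (norm x ^ r) \<partial>\<mu>) \<le> ennreal (1 / 2 * \<sigma>\<^sup>2 * fact r * V ^ (r - 2))"
begin

text \<open>The hypothesis starts at \<open>r = 2\<close>; the powers 0 and 1, needed for the mean,
  are dominated by a higher power plus 1.\<close>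

lemma integrable_norm_power: "integrable \<mu> (\<lambda>x. norm x ^ r)"
proof -
  have *: "integrable \<mu> (\<lambda>x. norm x ^ r)" if "r \<ge> 2" for r
    using moment[OF that] by (intro integrableI_nonneg) (auto simp: less_top[symmetric] top_unique)
  have "integrable \<mu> (\<lambda>x. 1 + norm x ^ (r + 2))"
    by (intro Bochner_Integration.integrable_add *) auto
  then show ?thesis
  proof (rule Bochner_Integration.integrable_bound)
    show "AE x in \<mu>. norm (norm x ^ r) \<le> norm (1 + norm x ^ (r + 2))"
    proof (intro AE_I2)
      fix x :: 'b
      have "norm x ^ r \<le> 1 + norm x ^ (r + 2)"
        by (cases "norm x \<le> 1")
          (auto intro: order_trans[OF power_le_one] order_trans[OF power_increasing[of r "r + 2"]])
      then show "norm (norm x ^ r) \<le> norm (1 + norm x ^ (r + 2))"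
        by simp
    qed
  qed auto
qed

lemma integrable_norm: "integrable \<mu> norm"
  using integrable_norm_power[of 1] by simp

lemma expectation_norm_power:
  assumes "r \<ge> 2"
  shows "expectation (\<lambda>x. norm x ^ r) \<le> 1 / 2 * \<sigma>\<^sup>2 * fact r * V ^ (r - 2)"
  using moment[OF assms] integrable_norm_power[of r] V_pos
  by (subst (asm) nn_integral_eq_integral) (auto simp: ennreal_le_iff)

text \<open>Lipschitz functions are continuous, hence measurable, and grow at most linearly.\<close>

lemma lipschitz_integrable:
  fixes h :: "'b \<Rightarrow> real"
  assumes h: "\<And>x y. \<bar>h x - h y\<bar> \<le> c * norm (x - y)"
  shows "integrable \<mu> h"
proof (rule Bochner_Integration.integrable_bound)
  show "integrable \<mu> (\<lambda>x. \<bar>h 0\<bar> + c * norm x)"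
    using integrable_norm by auto
  show "AE x in \<mu>. norm (h x) \<le> norm (\<bar>h 0\<bar> + c * norm x)"
    using h[of _ 0] by (intro AE_I2) (smt (verit) diff_zero real_norm_def)
  have "continuous_on UNIV h"
  proof (rule continuous_at_imp_continuous_on, rule ballI)
    fix x :: 'b
    have "((\<lambda>y. c * norm (y - x)) \<longlongrightarrow> c * norm (x - x)) (at x)"
      by (intro tendsto_intros)
    then have "((\<lambda>y. c * norm (y - x)) \<longlongrightarrow> 0) (at x)"
      by simp
    then have "((\<lambda>y. h y - h x) \<longlongrightarrow> 0) (at x)"
      by (rule Lim_null_comparison[rotated]) (simp add: h)
    then show "isCont h x"
      unfolding isCont_def by (simp add: LIM_zero_iff)
  qed
  then have "h \<in> borel_measurable borel"
    by (rule borel_measurable_continuous_onI)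
  then show "h \<in> borel_measurable \<mu>"
    by simp
qed

text \<open>Bernstein's argument: the linear term of the exponential series has mean zero, and the
  factorials in the moment bounds cancel those of the series. The power mean bound and Jensen's
  inequality together cost 2^r in the r-th term, so what remains is a geometric series of ratio
  \<open>2 * c * V * l\<close>.\<close>

lemma lipschitz_mgf:
  fixes h :: "'b \<Rightarrow> real"
  assumes h: "\<And>x y. \<bar>h x - h y\<bar> \<le> c * norm (x - y)"
    and c: "0 \<le> c" and l: "0 \<le> l" "2 * c * V * l < 1"
  shows "(\<integral>\<^sup>+ x. ennreal (exp (l * (h x - expectation h))) \<partial>\<mu>)
    \<le> ennreal (exp (l\<^sup>2 * (2 * c * \<sigma>)\<^sup>2 / (2 * (1 - 2 * c * V * l))))"
proof -
  define m where "m = expectation norm"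
  define D where "D x = l * (h x - expectation h)" for x
  define A where "A = l\<^sup>2 * (2 * c * \<sigma>)\<^sup>2 / (2 * (1 - 2 * c * V * l))"
  have m: "0 \<le> m" by (simp add: m_def)
  have A: "0 \<le> A"
  proof -
    have "0 \<le> 1 - 2 * c * V * l" using l by linarith
    then show ?thesis
      unfolding A_def by (intro divide_nonneg_nonneg mult_nonneg_nonneg zero_le_power2) auto
  qed
  have int_h: "integrable \<mu> h" using h by (rule lipschitz_integrable)
  then have int_D: "integrable \<mu> D" by (simp add: D_def[abs_def])
  have D_le: "\<bar>D x\<bar> \<le> l * c * (norm x + m)" for x
  proof -
    \<comment> \<open>Write the centred value as a mean of differences against an independent copy
      \<open>y\<close>; only differences of \<open>h\<close> are controlled.\<close>
    have "\<bar>h x - expectation h\<bar> = \<bar>expectation (\<lambda>y. h x - h y)\<bar>"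
      using int_h by (simp add: prob_space)
    also have "\<dots> \<le> expectation (\<lambda>y. \<bar>h x - h y\<bar>)"
      by (rule integral_abs_bound)
    also have "\<dots> \<le> expectation (\<lambda>y. c * (norm x + norm y))"
    proof (rule integral_mono)
      fix y show "\<bar>h x - h y\<bar> \<le> c * (norm x + norm y)"
        using h[of x y] mult_left_mono[OF norm_triangle_ineq4[of x y] c] by linarith
    qed (use int_h integrable_norm in auto)
    also have "\<dots> = c * (norm x + m)"
      using integrable_norm by (simp add: prob_space m_def)
    finally show ?thesis
      using l by (simp add: D_def abs_mult mult_left_mono mult.assoc)
  qed
  have "(\<integral>\<^sup>+ x. ennreal (exp (D x) - 1 - D x) \<partial>\<mu>)
      \<le> (\<integral>\<^sup>+ x. (\<Sum>k. ennreal ((l * c * (norm x + m)) ^ (k + 2) / fact (k + 2))) \<partial>\<mu>)"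
    by (intro nn_integral_mono exp_remainder_le D_le)
  also have "\<dots> = (\<Sum>k. \<integral>\<^sup>+ x. ennreal ((l * c * (norm x + m)) ^ (k + 2) / fact (k + 2)) \<partial>\<mu>)"
    by (intro nn_integral_suminf) measurable
  also have "\<dots> \<le> (\<Sum>k. ennreal ((2 * l * c)\<^sup>2 * \<sigma>\<^sup>2 / 2 * (2 * c * V * l) ^ k))"
  proof (intro suminf_le allI)
    fix k
    let ?r = "k + 2" and ?a = "(l * c) ^ (k + 2) * 2 ^ (k + 1) / fact (k + 2)"
    have a: "0 \<le> ?a" using l c by simp
    have "(\<integral>\<^sup>+ x. ennreal ((l * c * (norm x + m)) ^ ?r / fact ?r) \<partial>\<mu>)
        \<le> (\<integral>\<^sup>+ x. ennreal (?a * (norm x ^ ?r + m ^ ?r)) \<partial>\<mu>)"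
    proof (intro nn_integral_mono ennreal_leI)
      fix x :: 'b
      have "(norm x + m) ^ ?r \<le> 2 ^ (k + 1) * (norm x ^ ?r + m ^ ?r)"
        using power_add_le_power_mean[of "norm x" m ?r] m by simp
      then have "(l * c) ^ ?r * (norm x + m) ^ ?r / fact ?r
          \<le> (l * c) ^ ?r * (2 ^ (k + 1) * (norm x ^ ?r + m ^ ?r)) / fact ?r"
        using l c by (intro divide_right_mono mult_left_mono) auto
      then show "(l * c * (norm x + m)) ^ ?r / fact ?r \<le> ?a * (norm x ^ ?r + m ^ ?r)"
        by (simp only: power_mult_distrib mult.assoc times_divide_eq_left)
    qed
    also have "\<dots> = ennreal (expectation (\<lambda>x. ?a * (norm x ^ ?r + m ^ ?r)))"
      using a m by (intro nn_integral_eq_integral Bochner_Integration.integrable_mult_right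
        Bochner_Integration.integrable_add integrable_norm_power AE_I2 mult_nonneg_nonneg) auto
    also have "expectation (\<lambda>x. ?a * (norm x ^ ?r + m ^ ?r))
        = ?a * (expectation (\<lambda>x. norm x ^ ?r) + m ^ ?r)"
      using integrable_norm_power[of ?r]
      by (subst Bochner_Integration.integral_mult_right_zero, subst Bochner_Integration.integral_add)
        (simp_all only: integrable_const lebesgue_integral_const prob_space real_scaleR_def mult_1)
    also have "\<dots> \<le> ?a * (2 * (1 / 2 * \<sigma>\<^sup>2 * fact ?r * V ^ k))"
    proof (intro mult_left_mono[OF _ a])
      have "m ^ ?r \<le> expectation (\<lambda>x. norm x ^ ?r)"
        unfolding m_def by (intro expectation_power_le integrable_norm integrable_norm_power) auto
      then show "expectation (\<lambda>x. norm x ^ ?r) + m ^ ?r \<le> 2 * (1 / 2 * \<sigma>\<^sup>2 * fact ?r * V ^ k)"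
        using expectation_norm_power[of ?r] by simp
    qed
    also have "\<dots> = (2 * l * c)\<^sup>2 * \<sigma>\<^sup>2 / 2 * (2 * c * V * l) ^ k"
      by (simp add: power_mult_distrib power_add power2_eq_square del: fact_Suc)
    finally show "(\<integral>\<^sup>+ x. ennreal ((l * c * (norm x + m)) ^ ?r / fact ?r) \<partial>\<mu>)
        \<le> ennreal ((2 * l * c)\<^sup>2 * \<sigma>\<^sup>2 / 2 * (2 * c * V * l) ^ k)"
      by (simp add: ennreal_leI)
  qed auto
  also have "\<dots> = ennreal ((2 * l * c)\<^sup>2 * \<sigma>\<^sup>2 / 2 * (1 / (1 - 2 * c * V * l)))"
    using l c V_pos
    by (intro suminf_ennreal_eq sums_mult geometric_sums) (auto simp: abs_mult)
  also have "(2 * l * c)\<^sup>2 * \<sigma>\<^sup>2 / 2 * (1 / (1 - 2 * c * V * l)) = A"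
  proof -
    have "(2 * l * c)\<^sup>2 * \<sigma>\<^sup>2 / 2 * (1 / q) = l\<^sup>2 * (2 * c * \<sigma>)\<^sup>2 / (2 * q)" for q
      by (simp add: power_mult_distrib)
    then show ?thesis unfolding A_def .
  qed
  finally have rem: "(\<integral>\<^sup>+ x. ennreal (exp (D x) - 1 - D x) \<partial>\<mu>) \<le> ennreal A" .
  have nonneg: "0 \<le> exp (D x) - 1 - D x" for x
    using exp_ge_add_one_self[of "D x"] by linarith
  \<comment> \<open>The remainder is nonnegative with finite integral. This makes
    \<open>exp (D x)\<close> integrable, and only then may its mean be split into terms.\<close>
  have int_R: "integrable \<mu> (\<lambda>x. exp (D x) - 1 - D x)"
    using int_D rem nonneg
    by (intro integrableI_nonneg) (auto simp: less_top[symmetric] top_unique)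
  have R_le: "expectation (\<lambda>x. exp (D x) - 1 - D x) \<le> A"
    using rem nonneg A by (subst (asm) nn_integral_eq_integral[OF int_R]) (auto simp: ennreal_le_iff)
  have "integrable \<mu> (\<lambda>x. (exp (D x) - 1 - D x) + (1 + D x))"
    using int_R int_D by (intro Bochner_Integration.integrable_add) auto
  then have int_E: "integrable \<mu> (\<lambda>x. exp (D x))" by simp
  have "expectation (\<lambda>x. exp (D x) - 1 - D x) = expectation (\<lambda>x. exp (D x)) - 1 - expectation D"
    using int_E int_D by (simp add: prob_space)
  moreover have "expectation D = 0"
    using int_h by (simp add: D_def[abs_def] prob_space)
  ultimately have "expectation (\<lambda>x. exp (D x)) \<le> 1 + A"
    using R_le by simp
  \<comment> \<open>The exponential form turns the product over coordinates into a sum of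
    exponents.\<close>
  also have "\<dots> \<le> exp A"
    by (rule exp_ge_add_one_self)
  finally show ?thesis
    using int_E by (fold D_def A_def) (subst nn_integral_eq_integral, auto intro: ennreal_leI)
qed

end

section \<open>Concentration on product spaces\<close>

text \<open>Continuity lives on functions defined on all of \<open>nat\<close>, whereas points of
  the finite product are \<open>undefined\<close> beyond \<open>n\<close>. The two meet because
  \<open>f\<close> ignores coordinates from \<open>n\<close> on: resetting them to 0 maps the finite
  product measurably into the full one and leaves \<open>f\<close> unchanged.\<close>

lemma borel_measurable_PiM_lipschitz:
  fixes f :: "(nat \<Rightarrow> 'b::euclidean_space) \<Rightarrow> real"
  assumes f: "\<And>x y. \<bar>f x - f y\<bar> \<le> c * (\<Sum>i<n. norm (x i - y i))"
  shows "f \<in> borel_measurable (PiM {..<n} (\<lambda>_. borel))"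
proof -
  have "continuous_on UNIV f"
  proof (rule continuous_at_imp_continuous_on, rule ballI)
    fix x :: "nat \<Rightarrow> 'b"
    have "((\<lambda>y. y i) \<longlongrightarrow> x i) (at x)" for i
      using continuous_on_product_coordinates[of i]
      by (auto simp: continuous_on_def)
    then have "((\<lambda>y. c * (\<Sum>i<n. norm (y i - x i))) \<longlongrightarrow> c * (\<Sum>i<n. norm (x i - x i))) (at x)"
      by (intro tendsto_intros) auto
    then have "((\<lambda>y. c * (\<Sum>i<n. norm (y i - x i))) \<longlongrightarrow> 0) (at x)"
      by simp
    then have "((\<lambda>y. f y - f x) \<longlongrightarrow> 0) (at x)"
      by (rule Lim_null_comparison[rotated]) (simp add: f)
    then show "isCont f x"
      unfolding isCont_def by (simp add: LIM_zero_iff)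
  qed
  then have [measurable]: "f \<in> borel_measurable (PiM UNIV (\<lambda>_. borel))"
    using borel_measurable_continuous_onI
    by (subst measurable_cong_sets[OF sets_PiM_equal_borel refl]) auto
  have "(\<lambda>x i. if i < n then x i else 0) \<in> PiM {..<n} (\<lambda>_. borel) \<rightarrow>\<^sub>M PiM UNIV (\<lambda>_. borel :: 'b measure)"
  proof (rule measurable_PiM_single')
    show "(\<lambda>x. if i < n then x i else 0) \<in> PiM {..<n} (\<lambda>_. borel) \<rightarrow>\<^sub>M (borel :: 'b measure)" for i
      by (cases "i < n") simp_all
  qed auto
  then have "(\<lambda>x. f (\<lambda>i. if i < n then x i else 0)) \<in> borel_measurable (PiM {..<n} (\<lambda>_. borel))"
    by measurable
  moreover have "f (\<lambda>i. if i < n then x i else 0) = f x" for x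
    using f[of "\<lambda>i. if i < n then x i else 0" x] by simp
  ultimately show ?thesis by simp
qed

context bernstein_moments
begin

lemma lipschitz_integrable_PiM:
  fixes f :: "(nat \<Rightarrow> 'b) \<Rightarrow> real"
  assumes f: "\<And>x y. \<bar>f x - f y\<bar> \<le> c * (\<Sum>i<n. norm (x i - y i))"
  shows "integrable (PiM {..<n} (\<lambda>_. \<mu>)) f"
proof (rule Bochner_Integration.integrable_bound)
  interpret P: prob_space "PiM {..<n} (\<lambda>_. \<mu>)"
    by (intro prob_space_PiM prob_space_axioms)
  have "integrable (PiM {..<n} (\<lambda>_. \<mu>)) (\<lambda>x. norm (x i))" if "i < n" for i
  proof -
    have "integrable (distr (PiM {..<n} (\<lambda>_. \<mu>)) \<mu> (\<lambda>x. x i)) norm"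
      using that integrable_norm by (subst distr_PiM_component) (auto intro: prob_space_axioms)
    then show ?thesis
      using that by (subst (asm) integrable_distr_eq) auto
  qed
  moreover have "integrable (PiM {..<n} (\<lambda>_. \<mu>)) (\<lambda>_. \<bar>f (\<lambda>_. 0)\<bar>)"
    by simp
  ultimately show "integrable (PiM {..<n} (\<lambda>_. \<mu>)) (\<lambda>x. \<bar>f (\<lambda>_. 0)\<bar> + c * (\<Sum>i<n. norm (x i)))"
    by (intro Bochner_Integration.integrable_add Bochner_Integration.integrable_mult_right
        Bochner_Integration.integrable_sum) auto
  show "AE x in PiM {..<n} (\<lambda>_. \<mu>). norm (f x) \<le> norm (\<bar>f (\<lambda>_. 0)\<bar> + c * (\<Sum>i<n. norm (x i)))"
  proof (intro AE_I2)
    fix x :: "nat \<Rightarrow> 'b"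
    show "norm (f x) \<le> norm (\<bar>f (\<lambda>_. 0)\<bar> + c * (\<Sum>i<n. norm (x i)))"
      using f[of x "\<lambda>_. 0"] by simp
  qed
  show "f \<in> borel_measurable (PiM {..<n} (\<lambda>_. \<mu>))"
    using borel_measurable_PiM_lipschitz[OF f]
    by (subst measurable_cong_sets[OF sets_PiM_cong refl]) (auto simp: sets_eq)
qed

text \<open>Integrating out the last coordinate keeps the Lipschitz property in the others, so no
  conditional expectations are needed for the martingale argument.\<close>

lemma lipschitz_mgf_PiM:
  fixes f :: "(nat \<Rightarrow> 'b) \<Rightarrow> real"
  assumes f: "\<And>x y. \<bar>f x - f y\<bar> \<le> c * (\<Sum>i<n. norm (x i - y i))"
    and c: "0 \<le> c" and l: "0 \<le> l" "2 * c * V * l < 1"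
  shows "(\<integral>\<^sup>+ x. ennreal (exp (l * (f x - (\<integral>y. f y \<partial>PiM {..<n} (\<lambda>_. \<mu>))))) \<partial>PiM {..<n} (\<lambda>_. \<mu>))
    \<le> ennreal (exp (real n * (l\<^sup>2 * (2 * c * \<sigma>)\<^sup>2 / (2 * (1 - 2 * c * V * l)))))"
  using f
proof (induction n arbitrary: f)
  \<comment> \<open>The product over no coordinates is a point mass, so \<open>f\<close> equals its
    mean.\<close>
  case 0
  then show ?case
    by (simp add: PiM_empty lebesgue_integral_count_space_finite nn_integral_count_space_finite)
next
  case (Suc n)
  interpret product_sigma_finite "\<lambda>_::nat. \<mu>"
    by unfold_locales
  define A where "A = l\<^sup>2 * (2 * c * \<sigma>)\<^sup>2 / (2 * (1 - 2 * c * V * l))"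
  define P where "P = PiM {..<n} (\<lambda>_. \<mu>)"
  \<comment> \<open>\<open>g\<close> plays the conditional mean given the first \<open>n\<close>
    coordinates; \<open>f (x(n := y)) - g x\<close> is the last martingale difference.\<close>
  define g where "g x = (\<integral>y. f (x(n := y)) \<partial>\<mu>)" for x
  define E where "E = (\<integral>x. f x \<partial>PiM {..<Suc n} (\<lambda>_. \<mu>))"
  have P: "PiM {..<Suc n} (\<lambda>_. \<mu>) = PiM (insert n {..<n}) (\<lambda>_. \<mu>)"
    by (simp add: lessThan_Suc)
  have f': "\<bar>f x - f y\<bar> \<le> c * ((\<Sum>i<n. norm (x i - y i)) + norm (x n - y n))" for x y
    using Suc.prems[of x y] by simp
  have f_last: "\<bar>f (x(n := y)) - f (x(n := z))\<bar> \<le> c * norm (y - z)" for x y z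
    using f'[of "x(n := y)" "x(n := z)"] by simp
  have f_init: "\<bar>f (x(n := z)) - f (y(n := z))\<bar> \<le> c * (\<Sum>i<n. norm (x i - y i))" for x y z
    using f'[of "x(n := z)" "y(n := z)"] by (simp cong: sum.cong_simp)
  have int_last: "integrable \<mu> (\<lambda>y. f (x(n := y)))" for x
    by (rule lipschitz_integrable[OF f_last])
  have g: "\<bar>g x - g y\<bar> \<le> c * (\<Sum>i<n. norm (x i - y i))" for x y
  proof -
    have "\<bar>g x - g y\<bar> = \<bar>\<integral>z. f (x(n := z)) - f (y(n := z)) \<partial>\<mu>\<bar>"
      using int_last by (simp add: g_def)
    also have "\<dots> \<le> (\<integral>z. \<bar>f (x(n := z)) - f (y(n := z))\<bar> \<partial>\<mu>)"
      by (rule integral_abs_bound)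
    also have "\<dots> \<le> (\<integral>z. c * (\<Sum>i<n. norm (x i - y i)) \<partial>\<mu>)"
      using int_last f_init by (intro integral_mono) auto
    finally show ?thesis by (simp add: prob_space)
  qed
  have int_f: "integrable (PiM (insert n {..<n}) (\<lambda>_. \<mu>)) f"
    using lipschitz_integrable_PiM[OF Suc.prems] by (simp add: lessThan_Suc)
  then have [measurable]: "f \<in> borel_measurable (PiM (insert n {..<n}) (\<lambda>_. \<mu>))"
    by auto
  have [measurable]: "g \<in> borel_measurable P"
    using lipschitz_integrable_PiM[OF g] unfolding P_def by auto
  \<comment> \<open>By Fubini \<open>f\<close> and \<open>g\<close> have the same mean, so the
    induction hypothesis for \<open>g\<close> is centred at the right constant.\<close>
  have E: "E = (\<integral>x. g x \<partial>P)"
    unfolding E_def P P_def g_def using int_f by (intro product_integral_insert) auto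
  have "(\<integral>\<^sup>+ x. ennreal (exp (l * (f x - E))) \<partial>PiM {..<Suc n} (\<lambda>_. \<mu>))
      = (\<integral>\<^sup>+ x. (\<integral>\<^sup>+ y. ennreal (exp (l * (f (x(n := y)) - E))) \<partial>\<mu>) \<partial>P)"
    unfolding P P_def by (subst product_nn_integral_insert) auto
  also have "\<dots> \<le> (\<integral>\<^sup>+ x. ennreal (exp (l * (g x - E))) * ennreal (exp A) \<partial>P)"
  proof (intro nn_integral_mono)
    \<comment> \<open>Split the exponent at \<open>g x\<close>: the factor depending on
      \<open>y\<close> is a centred function of one coordinate, to which
      \<open>lipschitz_mgf\<close> applies.\<close>
    fix x
    have "(\<integral>\<^sup>+ y. ennreal (exp (l * (f (x(n := y)) - E))) \<partial>\<mu>)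
        = (\<integral>\<^sup>+ y. ennreal (exp (l * (g x - E))) * ennreal (exp (l * (f (x(n := y)) - g x))) \<partial>\<mu>)"
      by (simp add: algebra_simps flip: ennreal_mult exp_add)
    also have "\<dots> = ennreal (exp (l * (g x - E))) * (\<integral>\<^sup>+ y. ennreal (exp (l * (f (x(n := y)) - g x))) \<partial>\<mu>)"
      using int_last[of x] by (intro nn_integral_cmult) auto
    also have "\<dots> \<le> ennreal (exp (l * (g x - E))) * ennreal (exp A)"
      unfolding g_def A_def by (intro mult_left_mono lipschitz_mgf[OF f_last] c l) auto
    finally show "(\<integral>\<^sup>+ y. ennreal (exp (l * (f (x(n := y)) - E))) \<partial>\<mu>)
        \<le> ennreal (exp (l * (g x - E))) * ennreal (exp A)" .
  qed
  also have "\<dots> = (\<integral>\<^sup>+ x. ennreal (exp (l * (g x - E))) \<partial>P) * ennreal (exp A)"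
    by (intro nn_integral_multc) auto
  also have "\<dots> \<le> ennreal (exp (real n * A)) * ennreal (exp A)"
    unfolding E P_def A_def by (intro mult_right_mono Suc.IH g) auto
  also have "\<dots> = ennreal (exp (real (Suc n) * A))"
    by (simp add: distrib_right add.commute flip: ennreal_mult exp_add)
  finally show ?case unfolding E_def A_def .
qed

lemma lipschitz_concentration_upper:
  fixes f :: "(nat \<Rightarrow> 'b) \<Rightarrow> real"
  assumes f: "\<And>x y. \<bar>f x - f y\<bar> \<le> c * (\<Sum>i<n. norm (x i - y i))"
    and c: "0 < c" and n: "0 < n" and \<sigma>: "0 < \<sigma>" and t: "0 < t"
  defines "P \<equiv> PiM {..<n} (\<lambda>_. \<mu>)"
  shows "measure P {x \<in> space P. f x - (\<integral>y. f y \<partial>P) \<ge> t}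
    \<le> exp (- (t\<^sup>2 / (8 * \<sigma>\<^sup>2 * (real n * c\<^sup>2) + 4 * t * V * c)))"
proof -
  interpret P: prob_space P
    unfolding P_def by (intro prob_space_PiM prob_space_axioms)
  define S where "S = 4 * \<sigma>\<^sup>2 * (real n * c\<^sup>2)"
  \<comment> \<open>Not the exact minimiser of the Chernoff exponent, but the choice that makes
    \<open>1 - 2 * c * V * l\<close> equal to \<open>S / (S + 2 * c * V * t)\<close>; the quadratic
    term is then half of \<open>l * t\<close>.\<close>
  define l where "l = t / (S + 2 * c * V * t)"
  have S: "0 < S" using \<sigma> n c by (simp add: S_def)
  have d: "0 < S + 2 * c * V * t" using S c V_pos t by (simp add: add_pos_pos)
  have l: "0 < l" using d t by (simp add: l_def)
  have 1: "1 - 2 * c * V * l = S / (S + 2 * c * V * t)"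
    using d by (simp add: l_def field_simps)
  then have l1: "2 * c * V * l < 1"
    using divide_pos_pos[OF S d] by linarith
  have [measurable]: "f \<in> borel_measurable P"
    using lipschitz_integrable_PiM[OF f] unfolding P_def by auto
  have "emeasure P {x \<in> space P. f x - (\<integral>y. f y \<partial>P) \<ge> t}
      \<le> ennreal (exp (- l * t)) * (\<integral>\<^sup>+ x. ennreal (exp (l * (f x - (\<integral>y. f y \<partial>P)))) * indicator (space P) x \<partial>P)"
    using l by (intro Chernoff_ineq_nn_integral_ge) auto
  also have "(\<integral>\<^sup>+ x. ennreal (exp (l * (f x - (\<integral>y. f y \<partial>P)))) * indicator (space P) x \<partial>P)
      = (\<integral>\<^sup>+ x. ennreal (exp (l * (f x - (\<integral>y. f y \<partial>P)))) \<partial>P)"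
    by (intro nn_integral_cong) auto
  also have "ennreal (exp (- l * t)) * \<dots> \<le> ennreal (exp (- l * t)) *
      ennreal (exp (real n * (l\<^sup>2 * (2 * c * \<sigma>)\<^sup>2 / (2 * (1 - 2 * c * V * l)))))"
    unfolding P_def using c l l1 by (intro mult_left_mono lipschitz_mgf_PiM f) auto
  also have "\<dots> = ennreal (exp (- l * t + l\<^sup>2 * S / (2 * (S / (S + 2 * c * V * t)))))"
    unfolding 1 by (simp add: S_def power_mult_distrib mult_ac flip: ennreal_mult exp_add)
  also have "- l * t + l\<^sup>2 * S / (2 * (S / (S + 2 * c * V * t))) = - (t\<^sup>2 / (2 * (S + 2 * c * V * t)))"
    using S d by (simp add: l_def power2_eq_square divide_simps) (simp add: algebra_simps)
  also have "2 * (S + 2 * c * V * t) = 8 * \<sigma>\<^sup>2 * (real n * c\<^sup>2) + 4 * t * V * c"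
    by (simp add: S_def)
  finally show ?thesis
    by (simp add: P.emeasure_eq_measure)
qed

lemma lipschitz_concentration:
  fixes f :: "(nat \<Rightarrow> 'b) \<Rightarrow> real"
  assumes f: "\<And>x y. \<bar>f x - f y\<bar> \<le> c * (\<Sum>i<n. norm (x i - y i))"
    and c: "0 < c" and n: "0 < n" and \<sigma>: "0 < \<sigma>" and t: "0 < t"
  defines "P \<equiv> PiM {..<n} (\<lambda>_. \<mu>)"
  shows "measure P {x \<in> space P. \<bar>f x - (\<integral>y. f y \<partial>P)\<bar> \<ge> t}
    \<le> 2 * exp (- (t\<^sup>2 / (8 * \<sigma>\<^sup>2 * (real n * c\<^sup>2) + 4 * t * V * c)))"
proof -
  interpret P: prob_space P
    unfolding P_def by (intro prob_space_PiM prob_space_axioms)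
  have [measurable]: "f \<in> borel_measurable P"
    using lipschitz_integrable_PiM[OF f] unfolding P_def by auto
  let ?U = "{x \<in> space P. f x - (\<integral>y. f y \<partial>P) \<ge> t}"
  let ?L = "{x \<in> space P. - f x - (\<integral>y. - f y \<partial>P) \<ge> t}"
  have "measure P {x \<in> space P. \<bar>f x - (\<integral>y. f y \<partial>P)\<bar> \<ge> t} \<le> measure P (?U \<union> ?L)"
    by (intro P.finite_measure_mono) auto
  also have "\<dots> \<le> measure P ?U + measure P ?L"
    by (intro measure_Un_le) auto
  also have "measure P ?U \<le> exp (- (t\<^sup>2 / (8 * \<sigma>\<^sup>2 * (real n * c\<^sup>2) + 4 * t * V * c)))"
    unfolding P_def by (intro lipschitz_concentration_upper assms)
  also have "measure P ?L \<le> exp (- (t\<^sup>2 / (8 * \<sigma>\<^sup>2 * (real n * c\<^sup>2) + 4 * t * V * c)))"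
  proof -
    have "\<bar>- f x - - f y\<bar> \<le> c * (\<Sum>i<n. norm (x i - y i))" for x y
      using f[of x y] by linarith
    then show ?thesis
      unfolding P_def by (intro lipschitz_concentration_upper assms)
  qed
  finally show ?thesis by simp
qed

end

section \<open>Minkowski's inequality and sums of powers\<close>

text \<open>The endpoint 0 is the case of interest: there convexity reduces to (s z)^p \<le> s z^p,
  which holds because s^p \<le> s for 0 < s < 1.\<close>

lemma powr_convex_nonneg:
  assumes "p \<ge> 1"
  shows "convex_on {0..} (\<lambda>x::real. x powr p)"
proof (rule convex_onI)
  fix t x y :: real
  assume t: "0 < t" "t < 1" and xy: "x \<in> {0..}" "y \<in> {0..}"
  have scale: "(s * z) powr p \<le> s * z powr p" if "0 < s" "s < 1" "0 \<le> z" for s z :: real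
  proof -
    have "s powr p \<le> s powr 1"
      using that assms by (intro powr_mono') auto
    then show ?thesis
      using that by (simp add: powr_mult mult_right_mono)
  qed
  show "((1 - t) *\<^sub>R x + t *\<^sub>R y) powr p \<le> (1 - t) * x powr p + t * y powr p"
  proof (cases "x = 0 \<or> y = 0")
    case True
    then show ?thesis
      using scale[of t y] scale[of "1 - t" x] t xy by auto
  next
    case False
    then show ?thesis
      using convex_onD[OF powr_convex[OF assms], of t x y] t xy by auto
  qed
qed auto

text \<open>Phrased with radii \<open>A\<close> and \<open>B\<close> instead of norms, so no roots
  of extended integrals occur. The proof is convexity at \<open>f x / A\<close> and
  \<open>g x / B\<close> with weights proportional to \<open>A\<close> and \<open>B\<close>;
  dividing by the radii is why they must be positive.\<close>

lemma nn_integral_Minkowski: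
  fixes f g :: "'a \<Rightarrow> real"
  assumes p: "p \<ge> 1" and AB: "0 < A" "0 < B"
    and [measurable]: "f \<in> borel_measurable M" "g \<in> borel_measurable M"
    and nonneg: "\<And>x. 0 \<le> f x" "\<And>x. 0 \<le> g x"
    and f: "(\<integral>\<^sup>+ x. ennreal (f x powr p) \<partial>M) \<le> ennreal (A powr p)"
    and g: "(\<integral>\<^sup>+ x. ennreal (g x powr p) \<partial>M) \<le> ennreal (B powr p)"
  shows "(\<integral>\<^sup>+ x. ennreal ((f x + g x) powr p) \<partial>M) \<le> ennreal ((A + B) powr p)"
proof -
  define t where "t = B / (A + B)"
  have t: "0 \<le> t" "t \<le> 1" "1 - t = A / (A + B)"
    using AB by (auto simp: t_def field_simps)
  define a b where "a = (A + B) powr p * (1 - t) / A powr p" and "b = (A + B) powr p * t / B powr p"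
  have ab: "0 \<le> a" "0 \<le> b"
    using t AB by (auto simp: a_def b_def)
  have "(f x + g x) powr p \<le> a * f x powr p + b * g x powr p" for x
  proof -
    have "f x + g x = (A + B) * ((1 - t) * (f x / A) + t * (g x / B))"
    proof -
      have "(A + B) * (1 - t) = A" "(A + B) * t = B"
        using AB unfolding t(3) by (simp_all add: t_def)
      then have "(A + B) * (1 - t) * (f x / A) + (A + B) * t * (g x / B) = f x + g x"
        using AB by simp
      then show ?thesis by (simp add: distrib_left mult.assoc)
    qed
    then have "(f x + g x) powr p = (A + B) powr p * ((1 - t) * (f x / A) + t * (g x / B)) powr p"
      using AB t(1,2) nonneg by (simp add: powr_mult)
    also have "\<dots> \<le> (A + B) powr p * ((1 - t) * (f x / A) powr p + t * (g x / B) powr p)"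
      using convex_onD[OF powr_convex_nonneg[OF p], of t "f x / A" "g x / B"] t(1,2) AB nonneg
      by (intro mult_left_mono) auto
    also have "\<dots> = a * f x powr p + b * g x powr p"
      using AB nonneg by (simp add: a_def b_def powr_divide distrib_left)
    finally show ?thesis .
  qed
  then have "(\<integral>\<^sup>+ x. ennreal ((f x + g x) powr p) \<partial>M)
      \<le> (\<integral>\<^sup>+ x. ennreal a * ennreal (f x powr p) + ennreal b * ennreal (g x powr p) \<partial>M)"
    using ab by (intro nn_integral_mono) (simp add: ennreal_leI flip: ennreal_mult ennreal_plus)
  also have "\<dots> = ennreal a * (\<integral>\<^sup>+ x. ennreal (f x powr p) \<partial>M) + ennreal b * (\<integral>\<^sup>+ x. ennreal (g x powr p) \<partial>M)"
    by (simp add: nn_integral_add nn_integral_cmult)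
  also have "\<dots> \<le> ennreal a * ennreal (A powr p) + ennreal b * ennreal (B powr p)"
    by (intro add_mono mult_left_mono f g) auto
  also have "\<dots> = ennreal (a * A powr p + b * B powr p)"
    using ab by (simp flip: ennreal_mult)
  also have "a * A powr p + b * B powr p = (A + B) powr p"
  proof -
    have "a * A powr p = (A + B) powr p * (1 - t)" "b * B powr p = (A + B) powr p * t"
      using AB by (simp_all add: a_def b_def)
    then show ?thesis by (simp add: right_diff_distrib)
  qed
  finally show ?thesis .
qed

text \<open>The p-norm is below the 1-norm: each term is at most \<open>s i\<close> times the total
  to the power \<open>p - 1\<close>. This turns the p-cost of moving atoms into the sum that the
  concentration argument uses.\<close>

lemma sum_powr_le_powr_sum:
  fixes s :: "'i \<Rightarrow> real"
  assumes "p \<ge> 1" and s: "\<And>i. i \<in> I \<Longrightarrow> 0 \<le> s i" and I: "finite I"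
  shows "(\<Sum>i\<in>I. s i powr p) \<le> (\<Sum>i\<in>I. s i) powr p"
proof -
  define S where "S = (\<Sum>i\<in>I. s i)"
  have split: "z powr p = z * z powr (p - 1)" if "0 \<le> z" for z :: real
    using that by (cases "z = 0") (simp_all add: powr_diff)
  have "(\<Sum>i\<in>I. s i powr p) \<le> (\<Sum>i\<in>I. s i * S powr (p - 1))"
  proof (rule sum_mono)
    fix i assume i: "i \<in> I"
    have "s i \<le> S"
      using member_le_sum[OF i, of s] s I unfolding S_def by auto
    then show "s i powr p \<le> s i * S powr (p - 1)"
      using s[OF i] assms(1) by (simp add: split mult_left_mono powr_mono2)
  qed
  also have "\<dots> = S powr p"
    using s by (subst split) (auto simp: S_def sum_nonneg simp flip: sum_distrib_right)
  finally show ?thesis by (simp add: S_def)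
qed

section \<open>Extended powers and nearly optimal couplings\<close>

lemma epowr_ennreal: "0 \<le> x \<Longrightarrow> epowr (ennreal x) a = ennreal (x powr a)"
  by (simp add: epowr_def)

lemma epowr_mono: "x \<le> y \<Longrightarrow> 0 \<le> a \<Longrightarrow> epowr x a \<le> epowr y a"
  by (cases x; cases y) (auto simp: epowr_def ennreal_leI powr_mono2 top_unique)

lemma epowr_powr_inverse: "0 \<le> r \<Longrightarrow> 0 < p \<Longrightarrow> epowr (ennreal (r powr p)) (1 / p) = ennreal r"
  by (simp add: epowr_ennreal powr_powr)

text \<open>Moves the root to the other side, so that bounds are proved on the integrals themselves.
  At infinity both sides fail.\<close>

lemma epowr_inverse_le_iff:
  assumes "0 < p" "0 \<le> r"
  shows "epowr x (1 / p) \<le> ennreal r \<longleftrightarrow> x \<le> ennreal (r powr p)"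
proof
  assume *: "epowr x (1 / p) \<le> ennreal r"
  then obtain z where z: "x = ennreal z" "0 \<le> z"
    by (cases x) (auto simp: epowr_def top_unique)
  then have "z powr (1 / p) \<le> r"
    using * assms by (simp add: epowr_ennreal)
  then have "(z powr (1 / p)) powr p \<le> r powr p"
    using assms by (intro powr_mono2) auto
  then show "x \<le> ennreal (r powr p)"
    using z assms by (simp add: powr_powr ennreal_leI)
next
  assume "x \<le> ennreal (r powr p)"
  then show "epowr x (1 / p) \<le> ennreal r"
    using epowr_mono[of x "ennreal (r powr p)" "1 / p"] assms by (simp add: epowr_powr_inverse)
qed

lemma wasserstein_le:
  assumes "0 < p" "0 \<le> r" "\<pi> \<in> couplings \<mu> \<nu>"
    and "(\<integral>\<^sup>+ z. ennreal (norm (fst z - snd z) powr p) \<partial>\<pi>) \<le> ennreal (r powr p)"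
  shows "wasserstein p \<mu> \<nu> \<le> ennreal r"
  unfolding wasserstein_def using assms by (subst epowr_inverse_le_iff) (auto intro: INF_lower2)

text \<open>Strictness replaces an optimal coupling: a value strictly above an infimum is beaten by
  some member.\<close>

lemma wasserstein_lessE:
  assumes "0 < p" "0 \<le> r" "wasserstein p \<mu> \<nu> < ennreal r"
  obtains \<pi> where "\<pi> \<in> couplings \<mu> \<nu>"
    "(\<integral>\<^sup>+ z. ennreal (norm (fst z - snd z) powr p) \<partial>\<pi>) \<le> ennreal (r powr p)"
proof -
  let ?I = "INF \<pi>\<in>couplings \<mu> \<nu>. \<integral>\<^sup>+ z. ennreal (norm (fst z - snd z) powr p) \<partial>\<pi>"
  have "\<not> ennreal (r powr p) \<le> ?I"
  proof
    assume "ennreal (r powr p) \<le> ?I"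
    then have "ennreal r \<le> wasserstein p \<mu> \<nu>"
      using epowr_mono[of "ennreal (r powr p)" ?I "1 / p"] assms
      by (simp add: epowr_powr_inverse wasserstein_def)
    then show False using assms(3) by simp
  qed
  then show ?thesis
    using that by (auto simp: not_le INF_less_iff intro: less_imp_le)
qed

section \<open>Moving the atoms of an empirical measure\<close>

lemma sets_empirical_measure[simp, measurable_cong]: "sets (empirical_measure n x) = sets borel"
  by (simp add: empirical_measure_def)

lemma measurable_uniform_count_measure_borel:
  "x \<in> uniform_count_measure I \<rightarrow>\<^sub>M borel"
  by (auto simp: measurable_def sets_uniform_count_measure space_uniform_count_measure)

declare transpose_matrix_vector[simp del]

lemma borel_measurable_projection[measurable]:
  "(\<lambda>x. transpose E *v x) \<in> borel_measurable borel" for E :: "real^'k^'d"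
  by (intro borel_measurable_continuous_onI matrix_vector_mult_linear_continuous_on)

text \<open>Reduces transport between projected samples to transport between empirical measures in
  the smaller space.\<close>

lemma projection_empirical_measure:
  "projection_measure E (empirical_measure n x) = empirical_measure n (\<lambda>i. transpose E *v x i)"
  unfolding projection_measure_def empirical_measure_def
  by (subst distr_distr)
    (simp_all add: comp_def measurable_uniform_count_measure_borel borel_measurable_projection)

text \<open>The gluing step. The coupling is disintegrated over the finitely many atoms \<open>b i\<close>; an
  atom shared by several indices is split evenly between them, which is the weight \<open>w\<close>.\<close>

lemma coupling_empirical_move:
  fixes a b :: "nat \<Rightarrow> 'b::euclidean_space"
  assumes n: "n \<ge> 1" and p: "p \<ge> 1" and \<pi>: "\<pi> \<in> couplings (empirical_measure n b) \<nu>"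
    and AB: "0 < A" "0 < B"
    and A: "(\<integral>\<^sup>+ z. ennreal (norm (fst z - snd z) powr p) \<partial>\<pi>) \<le> ennreal (A powr p)"
    and B: "(\<Sum>i<n. norm (a i - b i) powr p) / real n \<le> B powr p"
  obtains \<pi>' where "\<pi>' \<in> couplings (empirical_measure n a) \<nu>"
    "(\<integral>\<^sup>+ z. ennreal (norm (fst z - snd z) powr p) \<partial>\<pi>') \<le> ennreal ((A + B) powr p)"
proof -
  interpret \<pi>: prob_space \<pi> using \<pi> by (simp add: couplings_def)
  have s[measurable_cong]: "sets \<pi> = sets (borel \<Otimes>\<^sub>M borel)"
    and fst_\<pi>: "distr \<pi> borel fst = empirical_measure n b" and snd_\<pi>: "distr \<pi> borel snd = \<nu>"
    using \<pi> by (auto simp: couplings_def)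
  define C where "C i = real (card {j\<in>{..<n}. b j = b i})" for i
  define w where "w i z = ennreal (indicator {b i} (fst z) / C i)" for i and z :: "'b \<times> 'b"
  define N where "N = count_space {..<n} \<Otimes>\<^sub>M \<pi>"
  \<comment> \<open>\<open>Q\<close> is the joint law of an index I and a pair (Y, Z): the pair has
    law \<open>\<pi>\<close>, and given the pair, I is uniform among the indices with
    \<open>b\<close> I = Y.\<close>
  define Q where "Q = density N (\<lambda>(i, z). w i z)"
  have C: "C i > 0" if "i < n" for i
    using that by (auto simp: C_def card_gt_0_iff)
  have [measurable]: "w i \<in> borel_measurable \<pi>" for i
    unfolding w_def by measurable
  have meas_N: "F \<in> N \<rightarrow>\<^sub>M K" if "\<And>i. i < n \<Longrightarrow> (\<lambda>z. F (i, z)) \<in> \<pi> \<rightarrow>\<^sub>M K"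
    for F and K :: "'c measure"
    unfolding N_def using that by (intro measurable_pair_measure_countable1) auto
  have int_Q: "(\<integral>\<^sup>+ x. F x \<partial>Q) = (\<Sum>i<n. \<integral>\<^sup>+ z. w i z * F (i, z) \<partial>\<pi>)"
    if F: "\<And>i. i < n \<Longrightarrow> (\<lambda>z. F (i, z)) \<in> borel_measurable \<pi>" for F
  proof -
    have [measurable]: "F \<in> borel_measurable N" "(\<lambda>(i, z). w i z) \<in> borel_measurable N"
      by (auto intro!: meas_N F)
    have "(\<integral>\<^sup>+ x. F x \<partial>Q) = (\<integral>\<^sup>+ x. (case x of (i, z) \<Rightarrow> w i z) * F x \<partial>N)"
      unfolding Q_def by (rule nn_integral_density) auto
    also have "\<dots> = (\<integral>\<^sup>+ i. \<integral>\<^sup>+ z. w i z * F (i, z) \<partial>\<pi> \<partial>count_space {..<n})"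
      unfolding N_def by (subst \<pi>.nn_integral_fst[symmetric]) (auto simp flip: N_def)
    finally show ?thesis
      by (simp add: nn_integral_count_space_finite)
  qed
  have [measurable]: "b ` {..<n} \<in> sets borel"
    by (intro borel_closed finite_imp_closed) auto
  \<comment> \<open>Away from the atoms all weights vanish, so they sum to 1 only almost
    everywhere.\<close>
  have atoms: "AE z in \<pi>. fst z \<in> b ` {..<n}"
  proof -
    have "AE y in empirical_measure n b. y \<in> b ` {..<n}"
      unfolding empirical_measure_def
      by (subst AE_distr_iff) (auto simp: space_uniform_count_measure
          measurable_uniform_count_measure_borel intro!: AE_I2)
    then show ?thesis
      unfolding fst_\<pi>[symmetric] by (subst (asm) AE_distr_iff) auto
  qed
  have sum_w: "AE z in \<pi>. (\<Sum>i<n. w i z) = 1"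
    using atoms
  proof eventually_elim
    case (elim z)
    then obtain j where j: "j < n" "fst z = b j" by auto
    have "(\<Sum>i<n. indicator {b i} (fst z) / C i) = (\<Sum>i\<in>{i\<in>{..<n}. b i = b j}. 1 / C j)"
      by (subst sum.inter_filter) (auto intro!: sum.cong simp: j C_def)
    also have "\<dots> = 1"
      using C[OF j(1)] j(1) by (auto simp: C_def)
    finally show ?case
      unfolding w_def by (subst sum_ennreal) (auto simp: C_def)
  qed
  \<comment> \<open>The atom \<open>b i\<close> has mass C/n and is shared by C indices, so every
    index receives 1/n.\<close>
  have int_w: "(\<integral>\<^sup>+ z. w i z \<partial>\<pi>) = ennreal (1 / real n)" if i: "i < n" for i
  proof -
    have "(\<integral>\<^sup>+ z. w i z \<partial>\<pi>) = (\<integral>\<^sup>+ y. ennreal (1 / C i) * indicator {b i} y \<partial>distr \<pi> borel fst)"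
      by (subst nn_integral_distr) (auto simp: w_def indicator_def intro!: nn_integral_cong)
    also have "\<dots> = ennreal (1 / C i) * emeasure (empirical_measure n b) {b i}"
      unfolding fst_\<pi> by (intro nn_integral_cmult_indicator) auto
    also have "emeasure (empirical_measure n b) {b i} = ennreal (1 / real n) * ennreal (C i)"
    proof -
      have "(\<Sum>j<n. indicator {b i} (b j)) = C i"
        by (simp add: C_def indicator_def sum.If_cases Int_def)
      then have "(\<Sum>j<n. emeasure (return borel (b j)) {b i}) = ennreal (C i)"
        by (simp add: ennreal_indicator[symmetric] sum_nonneg del: ennreal_indicator)
      then show ?thesis
        using n by (simp add: emeasure_empirical_measure)
    qed
    finally show ?thesis
      using C[OF i] by (simp flip: ennreal_mult)
  qed
  have int_Q_\<pi>: "(\<integral>\<^sup>+ x. F (snd x) \<partial>Q) = (\<integral>\<^sup>+ z. F z \<partial>\<pi>)"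
    if [measurable]: "F \<in> borel_measurable \<pi>" for F
  proof -
    have "(\<integral>\<^sup>+ x. F (snd x) \<partial>Q) = (\<integral>\<^sup>+ z. (\<Sum>i<n. w i z) * F z \<partial>\<pi>)"
      by (subst int_Q) (auto simp: nn_integral_sum sum_distrib_right)
    also have "\<dots> = (\<integral>\<^sup>+ z. F z \<partial>\<pi>)"
      using sum_w by (intro nn_integral_cong_AE) auto
    finally show ?thesis .
  qed
  \<comment> \<open>Under \<open>Q\<close> the index is uniform and determines the first point, so
    integrals over both collapse to an average over the atoms.\<close>
  have int_Q_index: "(\<integral>\<^sup>+ x. F (fst x) (fst (snd x)) \<partial>Q) = (\<Sum>i<n. F i (b i)) * ennreal (1 / real n)"
    if [measurable]: "\<And>i. F i \<in> borel_measurable borel" for F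
  proof -
    have "(\<integral>\<^sup>+ z. w i z * F i (fst z) \<partial>\<pi>) = F i (b i) * ennreal (1 / real n)" if "i < n" for i
    proof -
      have "(\<integral>\<^sup>+ z. w i z * F i (fst z) \<partial>\<pi>) = (\<integral>\<^sup>+ z. F i (b i) * w i z \<partial>\<pi>)"
        by (intro nn_integral_cong) (auto simp: w_def indicator_def mult.commute)
      then show ?thesis
        using that by (simp add: nn_integral_cmult int_w)
    qed
    then show ?thesis
      by (subst int_Q) (auto simp: sum_distrib_right)
  qed
  \<comment> \<open>Replace Y by \<open>a\<close> I and keep Z: this changes the first marginal and
    leaves the second alone.\<close>
  define T where "T x = (a (fst x), snd (snd x))" for x :: "nat \<times> 'b \<times> 'b"
  define \<pi>' where "\<pi>' = distr Q (borel \<Otimes>\<^sub>M borel) T"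
  have sets_Q: "sets Q = sets N" by (simp add: Q_def)
  have meas_Q: "F \<in> Q \<rightarrow>\<^sub>M K" if "\<And>i. i < n \<Longrightarrow> (\<lambda>z. F (i, z)) \<in> \<pi> \<rightarrow>\<^sub>M K"
    for F and K :: "'c measure"
    using meas_N[OF that] by (simp add: measurable_cong_sets[OF sets_Q refl])
  have T: "T \<in> Q \<rightarrow>\<^sub>M borel \<Otimes>\<^sub>M borel"
    using sets_Q meas_N[of T] by (simp add: measurable_cong_sets[OF sets_Q refl] T_def[abs_def])
  have fst_\<pi>': "distr \<pi>' borel fst = empirical_measure n a"
  proof (rule measure_eqI)
    fix S :: "'b set" assume "S \<in> sets (distr \<pi>' borel fst)"
    then have [measurable]: "S \<in> sets borel" by simp
    have "emeasure (distr \<pi>' borel fst) S = (\<integral>\<^sup>+ y. indicator S y \<partial>distr \<pi>' borel fst)"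
      by simp
    also have "\<dots> = (\<integral>\<^sup>+ x. indicator S (a (fst x)) \<partial>Q)"
      unfolding \<pi>'_def using T
      by (simp add: nn_integral_distr T_def del: nn_integral_indicator)
    also have "\<dots> = (\<Sum>i<n. indicator S (a i)) * ennreal (1 / real n)"
      by (rule int_Q_index[of "\<lambda>i _. indicator S (a i)"]) simp
    finally show "emeasure (distr \<pi>' borel fst) S = emeasure (empirical_measure n a) S"
      using n by (simp add: emeasure_empirical_measure mult.commute)
  qed simp
  have snd_\<pi>': "distr \<pi>' borel snd = \<nu>"
    unfolding snd_\<pi>[symmetric]
  proof (rule measure_eqI)
    fix S :: "'b set" assume "S \<in> sets (distr \<pi>' borel snd)"
    then have [measurable]: "S \<in> sets borel" by simp
    have "emeasure (distr \<pi>' borel snd) S = (\<integral>\<^sup>+ y. indicator S y \<partial>distr \<pi>' borel snd)"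
      by simp
    also have "\<dots> = (\<integral>\<^sup>+ x. indicator S (snd (snd x)) \<partial>Q)"
      unfolding \<pi>'_def using T
      by (simp add: nn_integral_distr T_def del: nn_integral_indicator)
    also have "\<dots> = (\<integral>\<^sup>+ z. indicator S (snd z) \<partial>\<pi>)"
      by (rule int_Q_\<pi>[of "\<lambda>z. indicator S (snd z)"]) measurable
    also have "\<dots> = (\<integral>\<^sup>+ y. indicator S y \<partial>distr \<pi> borel snd)"
      by (subst nn_integral_distr) auto
    finally show "emeasure (distr \<pi>' borel snd) S = emeasure (distr \<pi> borel snd) S"
      by simp
  qed simp
  have "prob_space \<pi>'"
  proof
    have "emeasure \<pi>' (space \<pi>') = emeasure (distr \<pi>' borel fst) UNIV"
      by (subst emeasure_distr) (auto simp: \<pi>'_def)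
    also have "\<dots> = 1"
      unfolding fst_\<pi>' using n by (simp add: emeasure_empirical_measure ennreal_of_nat_eq_real_of_nat flip: ennreal_mult)
    finally show "emeasure \<pi>' (space \<pi>') = 1" .
  qed
  then have cpl: "\<pi>' \<in> couplings (empirical_measure n a) \<nu>"
    using fst_\<pi>' snd_\<pi>' by (simp add: couplings_def) (simp add: \<pi>'_def)
  have "(\<integral>\<^sup>+ z. ennreal (norm (fst z - snd z) powr p) \<partial>\<pi>')
      = (\<integral>\<^sup>+ x. ennreal (norm (a (fst x) - snd (snd x)) powr p) \<partial>Q)"
    unfolding \<pi>'_def using T by (simp add: nn_integral_distr T_def)
  \<comment> \<open>Triangle inequality through Y: the first summand carries the cost of
    \<open>\<pi>\<close>, the second the cost of moving atoms index by index.\<close>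
  also have "\<dots> \<le> (\<integral>\<^sup>+ x. ennreal ((norm (fst (snd x) - snd (snd x)) + norm (a (fst x) - fst (snd x))) powr p) \<partial>Q)"
  proof (intro nn_integral_mono ennreal_leI powr_mono2)
    fix x :: "nat \<times> 'b \<times> 'b"
    show "norm (a (fst x) - snd (snd x)) \<le> norm (fst (snd x) - snd (snd x)) + norm (a (fst x) - fst (snd x))"
      using norm_triangle_ineq[of "fst (snd x) - snd (snd x)" "a (fst x) - fst (snd x)"] by simp
  qed (use p in auto)
  also have "\<dots> \<le> ennreal ((A + B) powr p)"
  proof (rule nn_integral_Minkowski[OF p AB])
    show "(\<lambda>x. norm (fst (snd x) - snd (snd x))) \<in> borel_measurable Q"
      "(\<lambda>x. norm (a (fst x) - fst (snd x))) \<in> borel_measurable Q"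
      unfolding measurable_cong_sets[OF sets_Q refl] by (auto intro!: meas_N)
    show "(\<integral>\<^sup>+ x. ennreal (norm (fst (snd x) - snd (snd x)) powr p) \<partial>Q) \<le> ennreal (A powr p)"
      by (subst int_Q_\<pi>[of "\<lambda>z. ennreal (norm (fst z - snd z) powr p)"]) (auto intro: A)
    have "(\<integral>\<^sup>+ x. ennreal (norm (a (fst x) - fst (snd x)) powr p) \<partial>Q)
        = (\<Sum>i<n. ennreal (norm (a i - b i) powr p)) * ennreal (1 / real n)"
      by (rule int_Q_index[of "\<lambda>i y. ennreal (norm (a i - y) powr p)"]) measurable
    also have "\<dots> = ennreal ((\<Sum>i<n. norm (a i - b i) powr p) / real n)"
      by (simp add: sum_nonneg flip: ennreal_mult)
    finally show "(\<integral>\<^sup>+ x. ennreal (norm (a (fst x) - fst (snd x)) powr p) \<partial>Q) \<le> ennreal (B powr p)"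
      using B by (simp add: ennreal_leI)
  qed auto
  finally show thesis
    by (rule that[OF cpl])
qed

lemma wasserstein_empirical_le:
  fixes a b :: "nat \<Rightarrow> 'b::euclidean_space"
  assumes n: "n \<ge> 1" and p: "p \<ge> 1"
  shows "wasserstein p (empirical_measure n a) \<nu> \<le> wasserstein p (empirical_measure n b) \<nu>
    + ennreal (real n powr (- (1 / p)) * (\<Sum>i<n. norm (a i - b i)))"
proof (cases "wasserstein p (empirical_measure n b) \<nu>")
  case (real r)
  define d where "d = real n powr (- (1 / p)) * (\<Sum>i<n. norm (a i - b i))"
  have d: "0 \<le> d" by (simp add: d_def sum_nonneg)
  \<comment> \<open>Half of the slack selects a nearly optimal coupling; the other half keeps the
    second radius positive when no atom moves.\<close>
  have "wasserstein p (empirical_measure n a) \<nu> \<le> ennreal (r + d) + ennreal e" if e: "0 < e" for e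
  proof -
    have "wasserstein p (empirical_measure n b) \<nu> < ennreal (r + e / 2)"
      using real e by (simp add: ennreal_less_iff)
    then obtain \<pi> where \<pi>: "\<pi> \<in> couplings (empirical_measure n b) \<nu>"
      "(\<integral>\<^sup>+ z. ennreal (norm (fst z - snd z) powr p) \<partial>\<pi>) \<le> ennreal ((r + e / 2) powr p)"
      using p real e by (elim wasserstein_lessE[rotated 2]) auto
    have "(\<Sum>i<n. norm (a i - b i) powr p) / real n \<le> (\<Sum>i<n. norm (a i - b i)) powr p / real n"
      using p by (intro divide_right_mono sum_powr_le_powr_sum) auto
    also have "\<dots> = d powr p"
    proof -
      have "(real n powr (- (1 / p))) powr p = 1 / real n"
        using n p by (simp only: powr_powr) (simp add: powr_minus_divide)
      then show ?thesis
        by (simp add: d_def powr_mult sum_nonneg)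
    qed
    also have "\<dots> \<le> (d + e / 2) powr p"
      using d e p by (intro powr_mono2) auto
    finally obtain \<pi>' where "\<pi>' \<in> couplings (empirical_measure n a) \<nu>"
      "(\<integral>\<^sup>+ z. ennreal (norm (fst z - snd z) powr p) \<partial>\<pi>')
        \<le> ennreal (((r + e / 2) + (d + e / 2)) powr p)"
      using real e d by (elim coupling_empirical_move[OF n p \<pi>(1) _ _ \<pi>(2), rotated 2]) auto
    then have "wasserstein p (empirical_measure n a) \<nu> \<le> ennreal ((r + e / 2) + (d + e / 2))"
      using p real e d by (intro wasserstein_le) auto
    also have "(r + e / 2) + (d + e / 2) = (r + d) + e" by simp
    finally show ?thesis
      using real d e by (simp add: ennreal_plus)
  qed
  then show ?thesis
    unfolding real(2) d_def[symmetric] using d real(1)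
    by (simp flip: ennreal_plus) (rule ennreal_le_epsilon, simp)
qed simp

section \<open>Geometry of orthonormal frames\<close>

lemma norm_stiefel_mult:
  fixes E :: "real^'k^'d"
  assumes "E \<in> stiefel"
  shows "norm (E *v v) = norm v"
proof -
  have "(E *v v) \<bullet> (E *v v) = (transpose E *v (E *v v)) \<bullet> v"
    by (simp add: transpose_matrix_vector dot_lmul_matrix)
  also have "\<dots> = v \<bullet> v"
    using assms by (simp add: stiefel_def matrix_vector_mul_assoc)
  finally show ?thesis
    by (simp add: norm_eq_sqrt_inner)
qed

text \<open>Cauchy-Schwarz for \<open>x\<close> and its projection
  \<open>E *v (transpose E *v x)\<close>, whose norm is that of \<open>transpose E *v x\<close>
  since \<open>E\<close> is an isometry.\<close>

lemma norm_transpose_stiefel_le: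
  fixes E :: "real^'k^'d"
  assumes "E \<in> stiefel"
  shows "norm (transpose E *v x) \<le> norm x"
proof -
  let ?v = "transpose E *v x"
  have "norm ?v * norm ?v = ?v \<bullet> ?v"
    by (metis power2_norm_eq_inner power2_eq_square)
  also have "\<dots> = x \<bullet> (E *v ?v)"
    by (simp add: transpose_matrix_vector dot_lmul_matrix)
  also have "\<dots> \<le> norm x * norm (E *v ?v)"
    by (rule norm_cauchy_schwarz)
  finally have "norm ?v * norm ?v \<le> norm x * norm ?v"
    by (simp only: norm_stiefel_mult[OF assms])
  then show ?thesis
    by (cases "?v = 0") (simp, rule mult_right_le_imp_le[of _ "norm ?v"], simp_all only: zero_less_norm_iff, simp)
qed

text \<open>Choose \<open>a\<close> of the same length as \<open>x\<close> and rotate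
  \<open>E0 *v a\<close> onto \<open>x\<close>. The rotated frame sends \<open>a\<close> to
  \<open>x\<close>, so its transpose sends \<open>x\<close> back to \<open>a\<close> without loss of
  length.\<close>

lemma exists_stiefel_norm_transpose_eq:
  fixes E0 :: "real^'k^'d"
  assumes "E0 \<in> stiefel"
  obtains E :: "real^'k^'d" where "E \<in> stiefel" "norm (transpose E *v x) = norm x"
proof -
  obtain a :: "real^'k" where a: "norm a = norm x"
    using vector_choose_size[of "norm x"] by auto
  then have "norm (E0 *v a) = norm x"
    using assms by (simp add: norm_stiefel_mult)
  then obtain f where f: "orthogonal_transformation f" "f (E0 *v a) = x"
    by (rule orthogonal_transformation_exists)
  define Q where "Q = matrix f"
  have Q: "transpose Q ** Q = mat 1" and Qx: "Q *v (E0 *v a) = x"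
    using f by (auto simp: Q_def orthogonal_transformation_matrix orthogonal_matrix)
  define E where "E = Q ** E0"
  have "transpose E ** E = transpose E0 ** (transpose Q ** Q) ** E0"
    by (simp add: E_def matrix_transpose_mul matrix_mul_assoc)
  then have E: "transpose E ** E = mat 1"
    using assms by (simp add: Q stiefel_def)
  have "transpose E *v x = transpose E *v (E *v a)"
    by (simp add: E_def Qx flip: matrix_vector_mul_assoc)
  also have "\<dots> = a"
    by (simp add: matrix_vector_mul_assoc E)
  finally show thesis
    using that[of E] E a by (simp add: stiefel_def)
qed

text \<open>Over an empty set of frames the supremum would be 0 and the tail condition void, hence
  \<open>ne\<close>.\<close>

lemma bernstein_moments_bernstein_tail:
  fixes \<mu> :: "(real^'d) measure"
  assumes "prob_space \<mu>" "sets \<mu> = sets borel" "V > 0" "bernstein_tail TYPE('k::finite) \<mu> \<sigma> V"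
    and ne: "(stiefel :: (real^'k^'d) set) \<noteq> {}"
  shows "bernstein_moments \<mu> \<sigma> V"
proof -
  obtain E0 :: "real^'k^'d" where E0: "E0 \<in> stiefel" using ne by auto
  interpret prob_space \<mu> by fact
  show ?thesis
  proof
    fix r :: nat assume r: "r \<ge> 2"
    have "(\<integral>\<^sup>+ x. ennreal (norm x ^ r) \<partial>\<mu>)
        \<le> (\<integral>\<^sup>+ x. (SUP E\<in>(stiefel :: (real^'k^'d) set). ennreal (norm (transpose E *v x) ^ r)) \<partial>\<mu>)"
    proof (rule nn_integral_mono)
      fix x :: "real^'d"
      obtain E :: "real^'k^'d" where "E \<in> stiefel" "norm (transpose E *v x) = norm x"
        by (rule exists_stiefel_norm_transpose_eq[OF E0])
      then show "ennreal (norm x ^ r)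
          \<le> (SUP E\<in>(stiefel :: (real^'k^'d) set). ennreal (norm (transpose E *v x) ^ r))"
        by (intro SUP_upper2[of E]) simp_all
    qed
    also have "\<dots> \<le> ennreal (1 / 2 * \<sigma>\<^sup>2 * fact r * V ^ (r - 2))"
      using assms(4) r unfolding bernstein_tail_def by blast
    finally show "(\<integral>\<^sup>+ x. ennreal (norm x ^ r) \<partial>\<mu>) \<le> ennreal (1 / 2 * \<sigma>\<^sup>2 * fact r * V ^ (r - 2))" .
  qed fact+
qed

section \<open>Finiteness and Lipschitz bounds for the projected distances\<close>

text \<open>The moments are of integer order but \<open>p\<close> is real, so compare with the next
  integer power. The value of \<open>R\<close> is immaterial; it serves only to prove
  finiteness.\<close>

lemma (in bernstein_moments) nn_integral_norm_powr_bound: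
  assumes "p \<ge> 1"
  obtains R where "0 < R" "(\<integral>\<^sup>+ x. ennreal (norm x powr p) \<partial>\<mu>) \<le> ennreal (R powr p)"
proof
  let ?v = "expectation (\<lambda>x. 1 + norm x ^ nat \<lceil>p\<rceil>)"
  have v: "0 \<le> ?v" by (intro Bochner_Integration.integral_nonneg) auto
  have "(\<integral>\<^sup>+ x. ennreal (norm x powr p) \<partial>\<mu>) \<le> (\<integral>\<^sup>+ x. ennreal (1 + norm x ^ nat \<lceil>p\<rceil>) \<partial>\<mu>)"
  proof (intro nn_integral_mono ennreal_leI)
    fix x :: 'b
    show "norm x powr p \<le> 1 + norm x ^ nat \<lceil>p\<rceil>"
    proof (cases "norm x \<le> 1")
      case True
      then have "norm x powr p \<le> 1 powr p"
        using assms by (intro powr_mono2) auto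
      then show ?thesis
        by (simp add: add_increasing2)
    next
      case False
      have "p \<le> real (nat \<lceil>p\<rceil>)" by linarith
      then have "norm x powr p \<le> norm x powr real (nat \<lceil>p\<rceil>)"
        using False by (intro powr_mono) auto
      then show ?thesis
        using False by (subst (asm) powr_realpow) auto
    qed
  qed
  also have "\<dots> = ennreal ?v"
    by (intro nn_integral_eq_integral Bochner_Integration.integrable_add integrable_norm_power) auto
  \<comment> \<open>Adding 1 makes the radius positive even if the mean were 0.\<close>
  also have "\<dots> \<le> ennreal (((?v + 1) powr (1 / p)) powr p)"
    using v assms by (simp add: powr_powr ennreal_leI)
  finally show "(\<integral>\<^sup>+ x. ennreal (norm x powr p) \<partial>\<mu>) \<le> ennreal (((?v + 1) powr (1 / p)) powr p)" .
  show "0 < (?v + 1) powr (1 / p)"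
    using v by (intro powr_gt_zero[THEN iffD2]) linarith
qed

text \<open>With all samples at 0 the empirical measure is a point mass, and pairing 0 with a
  \<open>\<nu>\<close>-distributed point costs exactly the p-th moment.\<close>

lemma wasserstein_empirical_zero_le:
  fixes \<nu> :: "'b::euclidean_space measure"
  assumes "n \<ge> 1" "0 < p" "0 \<le> R" "prob_space \<nu>" and [measurable_cong]: "sets \<nu> = sets borel"
    and R: "(\<integral>\<^sup>+ z. ennreal (norm z powr p) \<partial>\<nu>) \<le> ennreal (R powr p)"
  shows "wasserstein p (empirical_measure n (\<lambda>_. 0)) \<nu> \<le> ennreal R"
proof (rule wasserstein_le[OF assms(2,3)])
  interpret prob_space \<nu> by fact
  let ?\<pi> = "distr \<nu> (borel \<Otimes>\<^sub>M borel) (\<lambda>z. (0 :: 'b, z))"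
  have "distr ?\<pi> borel fst = empirical_measure n (\<lambda>_. 0)"
  proof (rule measure_eqI)
    fix A :: "'b set" assume "A \<in> sets (distr ?\<pi> borel fst)"
    then have A: "A \<in> sets borel" by simp
    have 1: "distr ?\<pi> borel fst = return borel 0"
      by (subst distr_distr) (simp_all add: comp_def)
    have "emeasure (empirical_measure n (\<lambda>_. 0)) A
        = (ennreal (1 / real n) * of_nat n) * emeasure (return borel 0) A"
      unfolding emeasure_empirical_measure[OF assms(1) A]
      by (simp only: sum_constant card_lessThan mult.assoc)
    also have "ennreal (1 / real n) * of_nat n = 1"
      using assms(1) by (simp add: ennreal_of_nat_eq_real_of_nat flip: ennreal_mult)
    finally show "emeasure (distr ?\<pi> borel fst) A = emeasure (empirical_measure n (\<lambda>_. 0)) A"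
      by (simp only: 1 mult_1)
  qed simp
  moreover have "distr ?\<pi> borel snd = \<nu>"
    by (subst distr_distr) (simp_all add: comp_def distr_id2[OF assms(5)[symmetric]])
  ultimately show "?\<pi> \<in> couplings (empirical_measure n (\<lambda>_. 0)) \<nu>"
    by (simp add: couplings_def prob_space_distr)
  show "(\<integral>\<^sup>+ z. ennreal (norm (fst z - snd z) powr p) \<partial>?\<pi>) \<le> ennreal (R powr p)"
    using R by (subst nn_integral_distr) auto
qed

lemma wasserstein_projection_le:
  fixes E :: "real^'k^'d"
  assumes "n \<ge> 1" "p \<ge> 1" and E: "E \<in> stiefel"
  shows "wasserstein p (projection_measure E (empirical_measure n x)) \<nu>
    \<le> wasserstein p (projection_measure E (empirical_measure n y)) \<nu>
      + ennreal (real n powr (- (1 / p)) * (\<Sum>i<n. norm (x i - y i)))"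
proof -
  let ?T = "\<lambda>z. transpose E *v z"
  have "wasserstein p (empirical_measure n (\<lambda>i. ?T (x i))) \<nu>
      \<le> wasserstein p (empirical_measure n (\<lambda>i. ?T (y i))) \<nu>
      + ennreal (real n powr (- (1 / p)) * (\<Sum>i<n. norm (?T (x i) - ?T (y i))))"
    by (rule wasserstein_empirical_le) fact+
  also have "\<dots> \<le> wasserstein p (empirical_measure n (\<lambda>i. ?T (y i))) \<nu>
      + ennreal (real n powr (- (1 / p)) * (\<Sum>i<n. norm (x i - y i)))"
    using norm_transpose_stiefel_le[OF E]
    by (intro add_left_mono ennreal_leI mult_left_mono sum_mono)
      (simp_all only: powr_ge_zero flip: matrix_vector_mult_diff_distrib)
  finally show ?thesis
    by (simp only: projection_empirical_measure)
qed

text \<open>No measurability of \<open>h\<close> and \<open>w\<close> is needed: on a non-measurable integrand \<open>nn_integral\<close> is the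
  lower integral, and Minkowski's inequality is applied to simple minorants of \<open>h\<close>.\<close>

lemma epowr_nn_integral_shift:
  fixes h w :: "'a \<Rightarrow> ennreal"
  assumes U: "prob_space U" and p: "p \<ge> 1" and d: "0 \<le> d"
    and hw: "\<And>x. x \<in> S \<Longrightarrow> h x \<le> w x + ennreal d"
  shows "epowr (\<integral>\<^sup>+ x\<in>S. epowr (h x) p \<partial>U) (1 / p)
    \<le> epowr (\<integral>\<^sup>+ x\<in>S. epowr (w x) p \<partial>U) (1 / p) + ennreal d"
proof (cases "epowr (\<integral>\<^sup>+ x\<in>S. epowr (w x) p \<partial>U) (1 / p)")
  case (real r)
  interpret prob_space U by fact
  have "epowr (\<integral>\<^sup>+ x\<in>S. epowr (h x) p \<partial>U) (1 / p) \<le> ennreal (r + d) + ennreal e" if e: "0 < e" for e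
  proof -
    let ?A = "r + e / 2" and ?B = "d + e / 2"
    have "epowr (\<integral>\<^sup>+ x\<in>S. epowr (w x) p \<partial>U) (1 / p) \<le> ennreal ?A"
      using real e by (simp add: ennreal_leI)
    then have w: "(\<integral>\<^sup>+ x\<in>S. epowr (w x) p \<partial>U) \<le> ennreal (?A powr p)"
      using p real e by (subst (asm) epowr_inverse_le_iff) auto
    have "(\<integral>\<^sup>+ x\<in>S. epowr (h x) p \<partial>U) \<le> ennreal ((?A + ?B) powr p)"
      unfolding nn_integral_def_finite[of U "\<lambda>x. epowr (h x) p * indicator S x"]
    proof (rule SUP_least)
      fix g assume "g \<in> {g. simple_function U g \<and> g \<le> (\<lambda>x. epowr (h x) p * indicator S x) \<and> (\<forall>x. g x < top)}"
      then have g: "simple_function U g" "\<And>x. g x \<le> epowr (h x) p * indicator S x" "\<And>x. g x < top"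
        by (auto simp: le_fun_def)
      then have [measurable]: "g \<in> borel_measurable U"
        by (intro borel_measurable_simple_function)
      \<comment> \<open>\<open>u\<close> is the p-th root of the minorant, hence below
        \<open>h\<close> on \<open>S\<close>; lowering it by \<open>d\<close> and truncating at 0
        gives a measurable function below \<open>w\<close> there.\<close>
      define u where "u x = enn2real (g x) powr (1 / p)" for x
      define v where "v x = max (u x - d) 0" for x
      have g_eq: "g x = ennreal (u x powr p)" for x
        using g(3)[of x] p by (simp add: u_def powr_powr)
      have v: "ennreal (v x powr p) \<le> epowr (w x) p * indicator S x" for x
      proof (cases "x \<in> S \<and> u x > d")
        case True
        have u: "0 \<le> u x" by (simp add: u_def)
        have "ennreal (u x) \<le> h x"
        proof (cases "h x")
          case (real z)
          then have "u x powr p \<le> z powr p"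
            using g(2)[of x] True unfolding g_eq by (simp add: epowr_ennreal)
          then have "(u x powr p) powr (1 / p) \<le> (z powr p) powr (1 / p)"
            by (rule powr_mono2[rotated 2]) (use p in auto)
          then show ?thesis
            using real u p by (simp add: powr_powr ennreal_leI)
        qed simp
        then have "ennreal (v x) + ennreal d \<le> w x + ennreal d"
          using hw[of x] True d by (simp add: v_def flip: ennreal_plus)
        then have "ennreal (v x) \<le> w x"
          using d by (simp add: ennreal_add_left_cancel_le add.commute)
        then have "epowr (ennreal (v x)) p \<le> epowr (w x) p"
          using p by (intro epowr_mono) auto
        then show ?thesis
          using True by (simp add: epowr_ennreal v_def)
      next
        case False
        have "u x = 0" if "x \<notin> S"
          using g(2)[of x] that by (simp add: u_def)
        then have "v x = 0"
          using False d by (auto simp: v_def)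
        then show ?thesis by simp
      qed
      have "integral\<^sup>S U g = (\<integral>\<^sup>+ x. g x \<partial>U)"
        using g(1) by (rule nn_integral_eq_simple_integral[symmetric])
      \<comment> \<open>\<open>u\<close> is at most \<open>v + d\<close>, and a constant has itself
        as its p-norm over a probability space, so Minkowski applies to \<open>v\<close> and the
        constant \<open>d + e / 2\<close>.\<close>
      also have "\<dots> \<le> (\<integral>\<^sup>+ x. ennreal ((v x + ?B) powr p) \<partial>U)"
        unfolding g_eq using p d e by (intro nn_integral_mono ennreal_leI powr_mono2) (auto simp: v_def u_def)
      also have "\<dots> \<le> ennreal ((?A + ?B) powr p)"
      proof (rule nn_integral_Minkowski[OF p])
        show "v \<in> borel_measurable U"
          unfolding v_def[abs_def] u_def[abs_def] by measurable
        show "(\<integral>\<^sup>+ x. ennreal (v x powr p) \<partial>U) \<le> ennreal (?A powr p)"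
          using w by (intro order_trans[OF nn_integral_mono[OF v]])
        show "(\<integral>\<^sup>+ x. ennreal (?B powr p) \<partial>U) \<le> ennreal (?B powr p)"
          by (simp add: emeasure_space_1)
      qed (use real d e in \<open>auto simp: v_def\<close>)
      finally show "integral\<^sup>S U g \<le> ennreal ((?A + ?B) powr p)" .
    qed
    then have "epowr (\<integral>\<^sup>+ x\<in>S. epowr (h x) p \<partial>U) (1 / p) \<le> ennreal (?A + ?B)"
      using p real d e by (subst epowr_inverse_le_iff) auto
    also have "?A + ?B = r + d + e" by simp
    finally show ?thesis
      using real d e by (simp add: ennreal_plus)
  qed
  then show ?thesis
    unfolding real(2) using d real(1)
    by (simp flip: ennreal_plus) (rule ennreal_le_epsilon, simp)
qed simp

text \<open>The shift in the bound for a single frame does not depend on the frame, so it passes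
  through the p-norm over frames; for \<open>PRW\<close> it passes through the supremum in the same
  way.\<close>

lemma IPRW_empirical_le:
  assumes "n \<ge> 1" "p \<ge> 1" "prob_space U"
  shows "IPRW U p (empirical_measure n x) \<mu> \<le> IPRW U p (empirical_measure n y) \<mu>
    + ennreal (real n powr (- (1 / p)) * (\<Sum>i<n. norm (x i - y i)))"
  unfolding IPRW_def
proof (rule epowr_nn_integral_shift[OF assms(3,2)])
  show "0 \<le> real n powr (- (1 / p)) * (\<Sum>i<n. norm (x i - y i))"
    by (simp add: sum_nonneg)
qed (rule wasserstein_projection_le[OF assms(1,2)])

lemma PRW_empirical_le:
  fixes \<mu> :: "(real^'d) measure"
  assumes "n \<ge> 1" "p \<ge> 1"
  shows "PRW TYPE('k::finite) p (empirical_measure n x) \<mu> \<le> PRW TYPE('k) p (empirical_measure n y) \<mu>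
    + ennreal (real n powr (- (1 / p)) * (\<Sum>i<n. norm (x i - y i)))"
  unfolding PRW_def
proof (rule SUP_least)
  fix E :: "real^'k^'d" assume E: "E \<in> stiefel"
  show "wasserstein p (projection_measure E (empirical_measure n x)) (projection_measure E \<mu>)
      \<le> (SUP E\<in>(stiefel :: (real^'k^'d) set).
          wasserstein p (projection_measure E (empirical_measure n y)) (projection_measure E \<mu>))
        + ennreal (real n powr (- (1 / p)) * (\<Sum>i<n. norm (x i - y i)))"
    by (rule order_trans[OF wasserstein_projection_le[OF assms E, where y = y]])
      (rule add_right_mono, rule SUP_upper[OF E])
qed

lemma wasserstein_projection_zero_le:
  fixes E :: "real^'k^'d"
  assumes "n \<ge> 1" "0 < p" "0 \<le> R" "prob_space \<mu>" and [measurable_cong]: "sets \<mu> = sets borel"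
    and R: "(\<integral>\<^sup>+ x. ennreal (norm x powr p) \<partial>\<mu>) \<le> ennreal (R powr p)" and E: "E \<in> stiefel"
  shows "wasserstein p (projection_measure E (empirical_measure n (\<lambda>_. 0))) (projection_measure E \<mu>)
    \<le> ennreal R"
proof -
  interpret prob_space \<mu> by fact
  have [measurable]: "(\<lambda>x. transpose E *v x) \<in> \<mu> \<rightarrow>\<^sub>M borel"
    unfolding measurable_cong_sets[OF assms(5) refl] by (rule borel_measurable_projection)
  have "(\<integral>\<^sup>+ x. ennreal (norm (transpose E *v x) powr p) \<partial>\<mu>) \<le> (\<integral>\<^sup>+ x. ennreal (norm x powr p) \<partial>\<mu>)"
    using norm_transpose_stiefel_le[OF E] assms(2)
    by (intro nn_integral_mono ennreal_leI powr_mono2) auto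
  then have "(\<integral>\<^sup>+ z. ennreal (norm z powr p) \<partial>projection_measure E \<mu>) \<le> ennreal (R powr p)"
    unfolding projection_measure_def using R by (subst nn_integral_distr) auto
  moreover have "prob_space (projection_measure E \<mu>)"
    unfolding projection_measure_def by (intro prob_space_distr) measurable
  ultimately show ?thesis
    using assms(1-3)
    by (simp only: projection_empirical_measure matrix_vector_mult_0_right)
      (intro wasserstein_empirical_zero_le, auto simp: projection_measure_def)
qed

lemma IPRW_empirical_zero_le:
  fixes \<mu> :: "(real^'d) measure" and U :: "(real^'k^'d) measure"
  assumes "n \<ge> 1" "0 < p" "0 \<le> R" "prob_space \<mu>" "sets \<mu> = sets borel" "prob_space U"
    and R: "(\<integral>\<^sup>+ x. ennreal (norm x powr p) \<partial>\<mu>) \<le> ennreal (R powr p)"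
  shows "IPRW U p (empirical_measure n (\<lambda>_. 0)) \<mu> \<le> ennreal R"
proof -
  interpret U: prob_space U by fact
  have "(\<integral>\<^sup>+ E\<in>stiefel. epowr (wasserstein p (projection_measure E (empirical_measure n (\<lambda>_. 0)))
      (projection_measure E \<mu>)) p \<partial>U) \<le> (\<integral>\<^sup>+ E. ennreal (R powr p) \<partial>U)"
  proof (rule nn_integral_mono)
    fix E :: "real^'k^'d"
    show "epowr (wasserstein p (projection_measure E (empirical_measure n (\<lambda>_. 0)))
        (projection_measure E \<mu>)) p * indicator stiefel E \<le> ennreal (R powr p)"
      using epowr_mono[OF wasserstein_projection_zero_le[OF assms(1-5) R, of E], of p] assms(2,3)
      by (auto simp: epowr_ennreal indicator_def)
  qed
  then show ?thesis
    unfolding IPRW_def using assms(2,3) by (subst epowr_inverse_le_iff) (auto simp: U.emeasure_space_1)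
qed

lemma PRW_empirical_zero_le:
  fixes \<mu> :: "(real^'d) measure"
  assumes "n \<ge> 1" "0 < p" "0 \<le> R" "prob_space \<mu>" "sets \<mu> = sets borel"
    and R: "(\<integral>\<^sup>+ x. ennreal (norm x powr p) \<partial>\<mu>) \<le> ennreal (R powr p)"
  shows "PRW TYPE('k::finite) p (empirical_measure n (\<lambda>_. 0)) \<mu> \<le> ennreal R"
  unfolding PRW_def by (intro SUP_least wasserstein_projection_zero_le assms)

section \<open>Real-valued deviations of i.i.d. samples\<close>

text \<open>\<open>enn2real\<close> sends infinity to 0, which could break the estimate; finiteness
  at \<open>y0\<close> spreads to every point through \<open>W\<close> itself.\<close>

lemma enn2real_lipschitz:
  fixes W :: "(nat \<Rightarrow> 'b::real_normed_vector) \<Rightarrow> ennreal"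
  assumes W: "\<And>x y. W x \<le> W y + ennreal (c * (\<Sum>i<n. norm (x i - y i)))"
    and finite: "W y0 < \<infinity>" and c: "0 \<le> c"
  shows "\<bar>enn2real (W x) - enn2real (W y)\<bar> \<le> c * (\<Sum>i<n. norm (x i - y i))"
proof -
  have fin: "W z < \<infinity>" for z
    using W[of z y0] finite by (auto simp: less_top[symmetric] top_unique)
  have *: "enn2real (W x) \<le> enn2real (W y) + c * (\<Sum>i<n. norm (x i - y i))" for x y
    using W[of x y] fin[of x] fin[of y] c
    by (cases "W x"; cases "W y") (auto simp: sum_nonneg simp flip: ennreal_plus)
  show ?thesis
    using *[of x y] *[of y x] by (simp add: norm_minus_commute abs_le_iff)
qed

lemma (in bernstein_moments) lipschitz_concentration_indep_vars:
  fixes X :: "nat \<Rightarrow> 'a \<Rightarrow> 'b" and f :: "(nat \<Rightarrow> 'b) \<Rightarrow> real"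
  assumes f: "\<And>x y. \<bar>f x - f y\<bar> \<le> c * (\<Sum>i<n. norm (x i - y i))"
    and c: "0 < c" and n: "0 < n" and \<sigma>: "0 < \<sigma>" and t: "0 < t"
    and M: "prob_space M" and indep: "prob_space.indep_vars M (\<lambda>_. borel) X {..<n}"
    and X: "\<And>i. i < n \<Longrightarrow> distr M borel (X i) = \<mu>"
  shows "measure M {\<omega> \<in> space M. \<bar>f (\<lambda>i. X i \<omega>) - (\<integral>\<omega>'. f (\<lambda>i. X i \<omega>') \<partial>M)\<bar> \<ge> t}
    \<le> 2 * exp (- (t\<^sup>2 / (8 * \<sigma>\<^sup>2 * (real n * c\<^sup>2) + 4 * t * V * c)))"
proof -
  interpret M: prob_space M by fact
  define P where "P = PiM {..<n} (\<lambda>_. \<mu>)"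
  \<comment> \<open>The restricted tuple is a point of the product space; \<open>f\<close> does not
    see the coordinates where it differs from the full family.\<close>
  define Y where "Y \<omega> = (\<lambda>i\<in>{..<n}. X i \<omega>)" for \<omega>
  have rv: "X i \<in> M \<rightarrow>\<^sub>M borel" if "i < n" for i
    using indep that unfolding M.indep_vars_def by auto
  have "distr M (PiM {..<n} (\<lambda>_. borel)) Y = PiM {..<n} (\<lambda>i. distr M borel (X i))"
    using indep rv n unfolding Y_def by (subst (asm) M.indep_vars_iff_distr_eq_PiM') auto
  also have "\<dots> = P"
    unfolding P_def by (intro PiM_cong) (auto simp: X)
  finally have P: "P = distr M (PiM {..<n} (\<lambda>_. borel)) Y" ..
  have Y[measurable]: "Y \<in> M \<rightarrow>\<^sub>M PiM {..<n} (\<lambda>_. borel)"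
    unfolding Y_def[abs_def] using rv by (intro measurable_restrict) auto
  have [measurable]: "f \<in> borel_measurable (PiM {..<n} (\<lambda>_. borel))"
    by (rule borel_measurable_PiM_lipschitz[OF f])
  have fY: "f (Y \<omega>) = f (\<lambda>i. X i \<omega>)" for \<omega>
    using f[of "Y \<omega>" "\<lambda>i. X i \<omega>"] by (simp add: Y_def)
  have "(\<integral>y. f y \<partial>P) = (\<integral>\<omega>. f (Y \<omega>) \<partial>M)"
    unfolding P by (intro integral_distr) measurable
  then have E: "(\<integral>y. f y \<partial>P) = (\<integral>\<omega>. f (\<lambda>i. X i \<omega>) \<partial>M)"
    by (simp only: fY)
  have "measure P {x \<in> space P. \<bar>f x - (\<integral>y. f y \<partial>P)\<bar> \<ge> t}
      = measure M (Y -` {x \<in> space P. \<bar>f x - (\<integral>y. f y \<partial>P)\<bar> \<ge> t} \<inter> space M)"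
    unfolding E by (subst (1) P, subst measure_distr) (auto simp: P)
  also have "Y -` {x \<in> space P. \<bar>f x - (\<integral>y. f y \<partial>P)\<bar> \<ge> t} \<inter> space M
      = {\<omega> \<in> space M. \<bar>f (\<lambda>i. X i \<omega>) - (\<integral>\<omega>'. f (\<lambda>i. X i \<omega>') \<partial>M)\<bar> \<ge> t}"
    unfolding E using measurable_space[OF Y] by (auto simp: fY P)
  finally show ?thesis
    using lipschitz_concentration[OF f c n \<sigma> t] by (simp add: P_def)
qed

theorem theorem3p7:
  fixes \<mu> :: "(real^'d) measure"
    and U :: "(real^'k^'d) measure"
    and M :: "'a measure"
    and X :: "nat \<Rightarrow> 'a \<Rightarrow> real^'d"
    and n :: nat and p \<sigma> V :: real
  assumes "CARD('k) \<le> CARD('d)"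
    and "p \<ge> 1"
    and "prob_space \<mu>" and "sets \<mu> = sets borel"
    and "\<sigma> > 0" and "V > 0" and "bernstein_tail TYPE('k) \<mu> \<sigma> V"
    and "uniform_on_stiefel U"
    and "n \<ge> 1"
    and "prob_space M"
    and "prob_space.indep_vars M (\<lambda>_. borel) X {..<n}"
    and "\<And>i. i < n \<Longrightarrow> distr M borel (X i) = \<mu>"
  shows "\<forall>W \<in> {IPRW U p, PRW TYPE('k) p}. \<forall>t>0.
    (let Z = (\<lambda>\<omega>. enn2real (W (empirical_measure n (\<lambda>i. X i \<omega>)) \<mu>)) in
      measure M {\<omega> \<in> space M. \<bar>Z \<omega> - (\<integral>\<omega>'. Z \<omega>' \<partial>M)\<bar> \<ge> t}
        \<le> 2 * exp (- (t\<^sup>2 / (8 * \<sigma>\<^sup>2 * real n powr (1 - 2 / p)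
                            + 4 * t * V * real n powr (- (1 / p))))))"
proof (intro ballI allI impI)
  fix W :: "(real^'d) measure \<Rightarrow> (real^'d) measure \<Rightarrow> ennreal" and t :: real
  assume W: "W \<in> {IPRW U p, PRW TYPE('k) p}" and t: "t > 0"
  \<comment> \<open>Frames exist because \<open>U\<close> gives them mass 1.\<close>
  have U: "prob_space U" "(stiefel :: (real^'k^'d) set) \<noteq> {}"
    using \<open>uniform_on_stiefel U\<close> by (auto simp: uniform_on_stiefel_def)
  interpret bernstein_moments \<mu> \<sigma> V
    using assms U(2) by (intro bernstein_moments_bernstein_tail)
  obtain R where R: "0 < R" "(\<integral>\<^sup>+ x. ennreal (norm x powr p) \<partial>\<mu>) \<le> ennreal (R powr p)"
    by (rule nn_integral_norm_powr_bound[OF \<open>p \<ge> 1\<close>])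
  define c where "c = real n powr (- (1 / p))"
  have c: "0 < c" using \<open>n \<ge> 1\<close> by (simp add: c_def)
  \<comment> \<open>The exponent is 1 from the number of coordinates and -1/p twice from
    \<open>c\<^sup>2\<close>.\<close>
  have nc: "real n * c\<^sup>2 = real n powr (1 - 2 / p)"
  proof -
    have "c\<^sup>2 = real n powr (- (1 / p) + - (1 / p))"
      unfolding c_def power2_eq_square powr_add ..
    then show ?thesis
      using \<open>n \<ge> 1\<close> by (simp add: powr_diff powr_minus_divide)
  qed
  have le: "W (empirical_measure n x) \<mu> \<le> W (empirical_measure n y) \<mu>
      + ennreal (c * (\<Sum>i<n. norm (x i - y i)))" for x y
    using W IPRW_empirical_le[OF \<open>n \<ge> 1\<close> \<open>p \<ge> 1\<close> U(1)] PRW_empirical_le[OF \<open>n \<ge> 1\<close> \<open>p \<ge> 1\<close>]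
    unfolding c_def by auto
  have "W (empirical_measure n (\<lambda>_. 0)) \<mu> \<le> ennreal R"
    using W assms R U(1) by (auto intro!: IPRW_empirical_zero_le PRW_empirical_zero_le)
  then have "W (empirical_measure n (\<lambda>_. 0)) \<mu> < \<infinity>"
    by (rule le_less_trans) simp
  then have "\<bar>enn2real (W (empirical_measure n x) \<mu>) - enn2real (W (empirical_measure n y) \<mu>)\<bar>
      \<le> c * (\<Sum>i<n. norm (x i - y i))" for x y
    using c by (intro enn2real_lipschitz[where W = "\<lambda>x. W (empirical_measure n x) \<mu>", OF le]) auto
  note concentration = lipschitz_concentration_indep_vars[OF this c _ \<open>\<sigma> > 0\<close> t \<open>prob_space M\<close> assms(11,12)]
  show "let Z = (\<lambda>\<omega>. enn2real (W (empirical_measure n (\<lambda>i. X i \<omega>)) \<mu>)) in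
      measure M {\<omega> \<in> space M. \<bar>Z \<omega> - (\<integral>\<omega>'. Z \<omega>' \<partial>M)\<bar> \<ge> t}
        \<le> 2 * exp (- (t\<^sup>2 / (8 * \<sigma>\<^sup>2 * real n powr (1 - 2 / p)
                            + 4 * t * V * real n powr (- (1 / p)))))"
    unfolding Let_def nc[symmetric] c_def[symmetric] using \<open>n \<ge> 1\<close> by (intro concentration) auto
qed

end
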